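(* Let $\gamma\equiv\gamma^{(2n)}=\{\gamma_{ij}\}_{i,j\in\mathbb{Z}_+^d,\;|i|+|j|\le 2n}$ be a complex sequence and let $\mathcal{P}\equiv\{p_i\}_{i=1}^m\subseteq\mathbb{C}^d[z,\bar z]$ with $\deg p_i=2k_i$ or $2k_i-1$ $(1\le i\le m)$. Let $K_{\mathcal{P}}:=\{z\in\mathbb{C}^d:p_i(z,\bar z)\ge0,\ 1\le i\le m\}$, let $M\equiv M^d(n)(\gamma)$ and let $r:=\operatorname{rank}M$. There exists a (minimal) $r$-atomic representing measure for $\gamma$ supported in $K_{\mathcal{P}}$ if and only if $M\ge0$ and $M$ admits a flat extension $M^d(n+1)$ for which $M^d_{p_i}(n+k_i)\ge0$ $(1\le i\le m)$. In this case, $M^d(n+1)$ admits a unique representing measure $\nu$, which is an $r$-atomic (minimal) representing measure for $\gamma$ supported in $K_{\mathcal{P}}$; moreover, $\nu$ has precisely $r-\operatorname{rank}M^d_{p_i}(n+k_i)$ atoms in $\mathcal{Z}(p_i):=\{z\in\mathbb{C}^d:p_i(z,\bar z)=0\}$ $(1\le i\le m)$.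
   Context: $\mathbb{C}^d[z,\bar z]$ is the space of complex polynomials in the indeterminates $z=(z_1,\dots,z_d)$, $\bar z=(\bar z_1,\dots,\bar z_d)$, and $\mathbb{C}^d_l[z,\bar z]$ is the subspace of total degree $\le l$, with basis the monomials $\bar z^iz^j$, $|i|+|j|\le l$ ($i,j\in\mathbb{Z}_+^d$, $|i|=i_1+\dots+i_d$). For $f\in\mathbb{C}_l^d[z,\bar z]$, $\hat f$ is its coefficient vector in this basis. A representing measure for $\gamma^{(2n)}$ (equivalently, for $M^d(n)(\gamma)$) is a positive Borel measure $\nu$ on $\mathbb{C}^d$ with $\gamma_{ij}=\int\bar z^iz^j\,d\nu$ (convergent) for all $|i|+|j|\le 2n$. It is $r$-atomic if $\nu=\sum_{s=1}^r\rho_s\delta_{\omega_s}$ with distinct $\omega_s\in\mathbb{C}^d$ and $\rho_s>0$. Riesz functional: $\Lambda_\gamma(\sum b_{rs}\bar z^rz^s)=\sum b_{rs}\gamma_{rs}$ on $\mathbb{C}^d_{2n}[z,\bar z]$. The moment matrix $M^d(n)(\gamma)$ is the square matrix with rows and columns indexed by the monomials $\bar z^iz^j$ ($|i|+|j|\le n$) determined by $\langle M^d(n)(\gamma)\hat f,\hat g\rangle=\Lambda_\gamma(f\bar g)$, $f,g\in\mathbb{C}_n^d[z,\bar z]$. $A\ge0$ means positive semidefinite. An extension $M^d(n+1)$ of $M^d(n)(\gamma)$ is a moment matrix $M^d(n+1)(\tilde\gamma)$, where $\tilde\gamma=\tilde\gamma^{(2n+2)}$ extends $\gamma$; for $M^d(n)\ge0$,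 a flat extension is a (positive semidefinite) extension with $\operatorname{rank}M^d(n+1)=\operatorname{rank}M^d(n)$. If $M^d(n)\ge0$ has a flat extension $M^d(n+1)$, then $M^d(n+1)$ has unique successive flat moment matrix extensions $M^d(n+2),M^d(n+3),\dots$; denote the resulting full sequence by $\tilde\gamma$. Localizing matrix: for $p\in\mathbb{C}^d[z,\bar z]$ with $\deg p=2k$ or $2k-1$, $M_p^d(n+k)$ (relative to $M^d(n+k)$) is the square matrix with rows and columns indexed by the monomials of degree $\le n$, determined by $\langle M_p^d(n+k)\hat f,\hat g\rangle=\Lambda_{\tilde\gamma}(pf\bar g)$ for $f,g\in\mathbb{C}_n^d[z,\bar z]$. *)

theory Defs
  imports
    "HOL-Analysis.Analysis"
    "HOL-Library.Poly_Mapping"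
    "HOL-Library.Function_Algebras"
begin

section \<open>Polynomials in $z$ and $\bar z$\<close>

text \<open>The pair \<open>(i, j)\<close> of multi-indices encodes the monomial $\bar z^i z^j$, and \<open>'d\<close> indexes
  the coordinates of $\mathbb{C}^d$, so $d$ is \<open>CARD('d)\<close>.\<close>

type_synonym 'd mono = "(nat ^ 'd) \<times> (nat ^ 'd)"

type_synonym 'd zpoly = "'d mono \<Rightarrow>\<^sub>0 complex"

definition mdeg :: "'d::finite mono \<Rightarrow> nat" where
  "mdeg a = (\<Sum>t\<in>UNIV. fst a $ t) + (\<Sum>t\<in>UNIV. snd a $ t)"

definition monomials :: "nat \<Rightarrow> 'd::finite mono set" where
  "monomials l = {a. mdeg a \<le> l}"

text \<open>Total degree; the zero polynomial has degree \<open>0\<close>.\<close>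

definition tdeg :: "'d::finite zpoly \<Rightarrow> nat" where
  "tdeg p = Max (insert 0 (mdeg ` Poly_Mapping.keys p))"

definition mono_eval :: "'d::finite mono \<Rightarrow> complex ^ 'd \<Rightarrow> complex" where
  "mono_eval a z = (\<Prod>t\<in>UNIV. cnj (z $ t) ^ (fst a $ t)) * (\<Prod>t\<in>UNIV. (z $ t) ^ (snd a $ t))"

definition zpoly_eval :: "'d::finite zpoly \<Rightarrow> complex ^ 'd \<Rightarrow> complex" where
  "zpoly_eval p z = (\<Sum>a\<in>Poly_Mapping.keys p. Poly_Mapping.lookup p a * mono_eval a z)"

text \<open>$\bar f$: conjugate the coefficients and interchange $z$ and $\bar z$.\<close>

definition zpoly_conj :: "'d::finite zpoly \<Rightarrow> 'd zpoly" where
  "zpoly_conj f =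
     (\<Sum>a\<in>Poly_Mapping.keys f. Poly_Mapping.single (prod.swap a) (cnj (Poly_Mapping.lookup f a)))"

text \<open>The coefficients are complex, so the condition $p(z, \bar z) \ge 0$ includes that this value
  is real.\<close>

definition semialg_set :: "(nat \<Rightarrow> 'd::finite zpoly) \<Rightarrow> nat \<Rightarrow> (complex ^ 'd) set" where
  "semialg_set p m = {z. \<forall>i\<in>{1..m}. zpoly_eval (p i) z \<in> \<real>\<^sub>\<ge>\<^sub>0}"

section \<open>Complex matrices indexed by a finite set\<close>

text \<open>A square matrix with rows and columns indexed by a finite set \<open>I\<close> is a function \<open>A\<close> of the row
  and the column index, of which only the values on \<open>I \<times> I\<close> matter.\<close>

text \<open>$\langle A v, v \rangle \ge 0$ for all complex vectors $v$; over the complex numbers this forces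
  \<open>A\<close> to be Hermitian.\<close>

definition psd_on :: "'i set \<Rightarrow> ('i \<Rightarrow> 'i \<Rightarrow> complex) \<Rightarrow> bool" where
  "psd_on I A \<longleftrightarrow>
     (\<forall>v :: 'i \<Rightarrow> complex. (\<Sum>a\<in>I. (\<Sum>b\<in>I. A a b * v b) * cnj (v a)) \<in> \<real>\<^sub>\<ge>\<^sub>0)"

definition cfun_scale :: "complex \<Rightarrow> ('i \<Rightarrow> complex) \<Rightarrow> 'i \<Rightarrow> complex" where
  "cfun_scale c f = (\<lambda>i. c * f i)"

lemma vector_space_cfun_scale: "vector_space cfun_scale"
  by unfold_locales (auto simp: cfun_scale_def fun_eq_iff algebra_simps)

text \<open>Dimension of the column space; columns are extended by \<open>0\<close> outside \<open>I\<close>.\<close>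

definition rank_on :: "'i set \<Rightarrow> ('i \<Rightarrow> 'i \<Rightarrow> complex) \<Rightarrow> nat" where
  "rank_on I A = vector_space.dim cfun_scale ((\<lambda>b. \<lambda>a. if a \<in> I then A a b else 0) ` I)"

section \<open>Moment matrices and localizing matrices\<close>

text \<open>A truncated sequence $\gamma^{(2n)}$ is represented by a function on all monomials, of which
  only the values in degrees \<open>\<le> 2 * n\<close> matter.\<close>

definition riesz :: "('d::finite mono \<Rightarrow> complex) \<Rightarrow> 'd zpoly \<Rightarrow> complex" where
  "riesz \<gamma> q = (\<Sum>a\<in>Poly_Mapping.keys q. Poly_Mapping.lookup q a * \<gamma> a)"

text \<open>The entry in row \<open>a\<close> and column \<open>b\<close> is $\Lambda_\gamma(p f \bar g)$ for the monomials
  \<open>f = b\<close> and \<open>g = a\<close>.\<close>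

definition loc_entry :: "('d::finite mono \<Rightarrow> complex) \<Rightarrow> 'd zpoly \<Rightarrow> 'd mono \<Rightarrow> 'd mono \<Rightarrow> complex"
  where
  "loc_entry \<gamma> p a b =
     riesz \<gamma> (p * Poly_Mapping.single b 1 * zpoly_conj (Poly_Mapping.single a 1))"

text \<open>The moment matrix $M(n)(\gamma)$ is the case \<open>p = 1\<close>.\<close>

definition moment_psd :: "nat \<Rightarrow> ('d::finite mono \<Rightarrow> complex) \<Rightarrow> bool" where
  "moment_psd n \<gamma> \<longleftrightarrow> psd_on (monomials n) (loc_entry \<gamma> 1)"

definition moment_rank :: "nat \<Rightarrow> ('d::finite mono \<Rightarrow> complex) \<Rightarrow> nat" where
  "moment_rank n \<gamma> = rank_on (monomials n) (loc_entry \<gamma> 1)"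

text \<open>\<open>(tdeg p + 1) div 2\<close> is the \<open>k\<close> with \<open>deg p = 2 k\<close> or \<open>deg p = 2 k - 1\<close>, so the localizing
  matrix $M_p(n + k)$ is indexed by \<open>monomials n\<close>.\<close>

definition loc_index :: "nat \<Rightarrow> 'd::finite zpoly \<Rightarrow> 'd mono set" where
  "loc_index N p = monomials (N - (tdeg p + 1) div 2)"

definition loc_psd :: "nat \<Rightarrow> 'd::finite zpoly \<Rightarrow> ('d mono \<Rightarrow> complex) \<Rightarrow> bool" where
  "loc_psd N p \<gamma> \<longleftrightarrow> psd_on (loc_index N p) (loc_entry \<gamma> p)"

definition loc_rank :: "nat \<Rightarrow> 'd::finite zpoly \<Rightarrow> ('d mono \<Rightarrow> complex) \<Rightarrow> nat" where
  "loc_rank N p \<gamma> = rank_on (loc_index N p) (loc_entry \<gamma> p)"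

section \<open>Flat extensions\<close>

text \<open>$M(n+1)(\tau)$ is a flat extension of $M(n)(\gamma)$.\<close>

definition flat_extension ::
  "nat \<Rightarrow> ('d::finite mono \<Rightarrow> complex) \<Rightarrow> ('d mono \<Rightarrow> complex) \<Rightarrow> bool" where
  "flat_extension n \<gamma> \<tau> \<longleftrightarrow>
     (\<forall>a\<in>monomials (2 * n). \<tau> a = \<gamma> a) \<and>
     moment_psd (n + 1) \<tau> \<and>
     moment_rank (n + 1) \<tau> = moment_rank n \<gamma>"

text \<open>The full sequence whose moment matrices are the successive flat extensions
  $M(N+1), M(N+2), \dots$ of $M(N)(\tau)$; it exists and is unique if $M(N)(\tau)$ is itself a
  flat extension of a positive semidefinite $M(N-1)$.\<close>

definition full_sequence ::
  "nat \<Rightarrow> ('d::finite mono \<Rightarrow> complex) \<Rightarrow> 'd mono \<Rightarrow> complex" where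
  "full_sequence N \<tau> =
     (THE \<sigma>. (\<forall>a\<in>monomials (2 * N). \<sigma> a = \<tau> a) \<and> (\<forall>l\<ge>N. flat_extension l \<sigma> \<sigma>))"

section \<open>Representing measures\<close>

definition representing_measure ::
  "nat \<Rightarrow> ('d::finite mono \<Rightarrow> complex) \<Rightarrow> (complex ^ 'd) measure \<Rightarrow> bool" where
  "representing_measure n \<gamma> \<nu> \<longleftrightarrow>
     sets \<nu> = sets borel \<and>
     (\<forall>a\<in>monomials (2 * n). has_bochner_integral \<nu> (mono_eval a) (\<gamma> a))"

definition r_atomic :: "nat \<Rightarrow> ('a::topological_space) measure \<Rightarrow> bool" where
  "r_atomic r \<nu> \<longleftrightarrow>
     sets \<nu> = sets borel \<and>
     (\<exists>(\<omega> :: nat \<Rightarrow> 'a) (\<rho> :: nat \<Rightarrow> real).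
        inj_on \<omega> {1..r} \<and> (\<forall>s\<in>{1..r}. \<rho> s > 0) \<and>
        (\<forall>A\<in>sets borel. emeasure \<nu> A = (\<Sum>s=1..r. ennreal (\<rho> s) * indicator A (\<omega> s))))"

text \<open>Minimal: no representing measure has fewer atoms.\<close>

definition minimal_atomic_measure ::
  "nat \<Rightarrow> ('d::finite mono \<Rightarrow> complex) \<Rightarrow> nat \<Rightarrow> (complex ^ 'd) measure \<Rightarrow> bool" where
  "minimal_atomic_measure n \<gamma> r \<nu> \<longleftrightarrow>
     representing_measure n \<gamma> \<nu> \<and> r_atomic r \<nu> \<and>
     (\<forall>\<mu> s. representing_measure n \<gamma> \<mu> \<and> r_atomic s \<mu> \<longrightarrow> r \<le> s)"

definition msupport :: "('a::topological_space) measure \<Rightarrow> 'a set" where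
  "msupport \<nu> = {x. \<forall>U. open U \<and> x \<in> U \<longrightarrow> emeasure \<nu> U > 0}"

definition atoms :: "'a measure \<Rightarrow> 'a set" where
  "atoms \<nu> = {x. emeasure \<nu> {x} > 0}"

section \<open>The defining property of localizing matrices\<close>

lemma finite_monomials: "finite (monomials l :: 'd::finite mono set)"
proof -
  define S :: "(nat ^ 'd) set" where "S = (\<lambda>f. \<chi> t. f t) ` (PiE UNIV (\<lambda>_. {..l}))"
  have fin: "finite S" unfolding S_def by (intro finite_imageI finite_PiE) auto
  have *: "v \<in> S" if "(\<Sum>t\<in>UNIV. v $ t) \<le> l" for v :: "nat ^ 'd"
  proof -
    have "v $ t \<le> l" for t
      using member_le_sum[of t UNIV "\<lambda>t. v $ t"] that by fastforce
    then have "(\<lambda>t. v $ t) \<in> PiE UNIV (\<lambda>_. {..l})" by auto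
    moreover have "v = (\<chi> t. v $ t)" by (simp add: vec_eq_iff)
    ultimately show ?thesis unfolding S_def by (intro image_eqI)
  qed
  have "monomials l \<subseteq> S \<times> S"
  proof
    fix a :: "'d mono" assume "a \<in> monomials l"
    then have "(\<Sum>t\<in>UNIV. fst a $ t) \<le> l" "(\<Sum>t\<in>UNIV. snd a $ t) \<le> l"
      by (simp_all add: monomials_def mdeg_def)
    then have "fst a \<in> S" "snd a \<in> S" by (simp_all add: *)
    then show "a \<in> S \<times> S" by (simp add: mem_Times_iff)
  qed
  then show ?thesis using fin by (meson finite_SigmaI finite_subset)
qed

lemma riesz_superset:
  assumes "finite S" "Poly_Mapping.keys q \<subseteq> S"
  shows "riesz \<gamma> q = (\<Sum>a\<in>S. Poly_Mapping.lookup q a * \<gamma> a)"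
  unfolding riesz_def by (rule sum.mono_neutral_left) (use assms in \<open>auto simp: in_keys_iff\<close>)

lemma riesz_add: "riesz \<gamma> (q + q') = riesz \<gamma> q + riesz \<gamma> q'"
proof -
  define S where "S = Poly_Mapping.keys q \<union> Poly_Mapping.keys q'"
  have S: "finite S" "Poly_Mapping.keys q \<subseteq> S" "Poly_Mapping.keys q' \<subseteq> S"
    "Poly_Mapping.keys (q + q') \<subseteq> S"
    unfolding S_def using keys_add[of q q'] by auto
  show ?thesis
    by (simp add: riesz_superset[OF S(1)] S lookup_add algebra_simps sum.distrib)
qed

lemma riesz_sum: "riesz \<gamma> (\<Sum>x\<in>X. q x) = (\<Sum>x\<in>X. riesz \<gamma> (q x))"
  by (induction X rule: infinite_finite_induct) (auto simp: riesz_add, auto simp: riesz_def)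

lemma lookup_const_mult:
  "Poly_Mapping.lookup (Poly_Mapping.single 0 c * q) a = c * Poly_Mapping.lookup q a"
  for q :: "'d::finite zpoly"
  by (simp add: Poly_Mapping.map.rep_eq when_def flip: mult_map_scale_conv_mult)

lemma riesz_const_mult: "riesz \<gamma> (Poly_Mapping.single 0 c * q) = c * riesz \<gamma> q"
proof -
  have "Poly_Mapping.keys (Poly_Mapping.single 0 c * q) \<subseteq> Poly_Mapping.keys q"
    by (auto simp: in_keys_iff lookup_const_mult)
  then show ?thesis
    by (subst riesz_superset[OF Poly_Mapping.finite_keys[of q]])
      (simp_all add: lookup_const_mult sum_distrib_left mult.assoc riesz_def)
qed

lemma zpoly_expand:
  fixes f :: "'d::finite zpoly"
  assumes "finite I" "Poly_Mapping.keys f \<subseteq> I"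
  shows "f = (\<Sum>b\<in>I. Poly_Mapping.single 0 (Poly_Mapping.lookup f b) * Poly_Mapping.single b 1)"
  using assms
  by (intro poly_mapping_eqI)
    (auto simp: lookup_sum mult_single lookup_single when_def in_keys_iff sum.delta)

lemma zpoly_conj_expand:
  assumes "finite I" "Poly_Mapping.keys g \<subseteq> I"
  shows "zpoly_conj g =
    (\<Sum>a\<in>I. Poly_Mapping.single 0 (cnj (Poly_Mapping.lookup g a)) *
      zpoly_conj (Poly_Mapping.single a 1))"
  unfolding zpoly_conj_def
  by (rule sum.mono_neutral_cong_left) (use assms in \<open>auto simp: mult_single in_keys_iff\<close>)

text \<open>With \<open>I = monomials n\<close>, this is $\langle M_p \hat f, \hat g \rangle = \Lambda_\gamma(p f \bar g)$.\<close>

lemma loc_entry_riesz: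
  assumes I: "finite I" and f: "Poly_Mapping.keys f \<subseteq> I" and g: "Poly_Mapping.keys g \<subseteq> I"
  shows "(\<Sum>a\<in>I. (\<Sum>b\<in>I. loc_entry \<gamma> p a b * Poly_Mapping.lookup f b) *
      cnj (Poly_Mapping.lookup g a)) =
    riesz \<gamma> (p * f * zpoly_conj g)"
proof -
  have "p * f =
     (\<Sum>b\<in>I. p * (Poly_Mapping.single 0 (Poly_Mapping.lookup f b) * Poly_Mapping.single b 1))"
    by (subst zpoly_expand[OF I f]) (rule sum_distrib_left)
  then have "p * f * zpoly_conj g =
     (\<Sum>b\<in>I. p * (Poly_Mapping.single 0 (Poly_Mapping.lookup f b) * Poly_Mapping.single b 1)) *
     (\<Sum>a\<in>I. Poly_Mapping.single 0 (cnj (Poly_Mapping.lookup g a)) *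
        zpoly_conj (Poly_Mapping.single a 1))"
    by (simp only: zpoly_conj_expand[OF I g])
  also have "\<dots> = (\<Sum>a\<in>I. \<Sum>b\<in>I. Poly_Mapping.single 0 (Poly_Mapping.lookup f b) *
     (Poly_Mapping.single 0 (cnj (Poly_Mapping.lookup g a)) *
       (p * Poly_Mapping.single b 1 * zpoly_conj (Poly_Mapping.single a 1))))"
    by (subst sum_product, subst sum.swap) (simp only: mult_ac)
  finally have "riesz \<gamma> (p * f * zpoly_conj g) = (\<Sum>a\<in>I. \<Sum>b\<in>I.
     Poly_Mapping.lookup f b * (cnj (Poly_Mapping.lookup g a) * loc_entry \<gamma> p a b))"
    by (simp only: riesz_sum riesz_const_mult loc_entry_def)
  then show ?thesis
    by (simp only: sum_distrib_left mult_ac)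
qed

end

theory Submission
  imports Defs "HOL-Computational_Algebra.Fundamental_Theorem_Algebra"
begin

text \<open>
  Put \<open>\<langle>f, g\<rangle> = \<Lambda>(f \<cdot> cnj g)\<close> on the polynomials of degree at most \<open>n + 1\<close>. Flatness says that this
  space is spanned by its kernel and the polynomials of degree at most \<open>n\<close>, so multiplication by each
  $z_t$ and $\bar z_t$ induces commuting operators on the finite-dimensional quotient. They have a
  joint eigenvector \<open>e\<close>; its eigenvalues form a point \<open>w\<close>, and after scaling \<open>e(w) = 1\<close> and
  \<open>\<langle>f, e\<rangle> = \<rho> f(w)\<close> with \<open>\<rho> > 0\<close>. Subtracting the moments of the point mass \<open>\<rho> \<delta>\<^sub>w\<close> leaves a flat positive
  semidefinite form with larger kernel, and iterating until the form vanishes gives an atomic measure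
  together with interpolation polynomials of degree at most \<open>n\<close> at its atoms.

  These interpolation polynomials yield everything else: they force any other representing measure
  onto the same atoms with the same weights, hence also determine the full sequence, they make
  the rank of a localizing matrix the number of atoms off the zero set of \<open>p\<close>, and testing
  positivity of a localizing matrix on them gives \<open>p \<ge> 0\<close> at each atom.
\<close>

section \<open>Linear algebra\<close>

text \<open>The obstacle is the degree bound: two multiplications applied to a polynomial of degree
  \<open>n\<close> may lead to degree \<open>n + 2\<close>, outside the space on which the form is
  controlled. Membership in the kernel is therefore tested only against polynomials of degree at
  most \<open>n\<close>; by flatness these represent every class, and they leave room for one factor
  to move across the form as its conjugate. One joint eigenvector per stage replaces a simultaneous
  diagonalization. The interpolation polynomials found so far lie in the kernel of the remaining
  form. Hence they vanish at the next atom and can be subtracted from the next eigenvector without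
  changing its pairings; their independence bounds the number of stages. In the converse direction,
  where a measure is given, polynomials of the same kind come from the equality of the rank and the
  number of atoms, so both directions work with one description of the measure.\<close>

context vector_space
begin

lemma span_family_sum: "(\<Sum>s\<in>S. scale (u s) (f s)) \<in> span (f ` S)"
  by (rule span_sum, rule span_scale, rule span_base, rule imageI)

lemma span_finite_image:
  assumes "finite S"
  shows "span (f ` S) = range (\<lambda>u. \<Sum>s\<in>S. scale (u s) (f s))"
proof
  show "span (f ` S) \<subseteq> range (\<lambda>u. \<Sum>s\<in>S. scale (u s) (f s))"
  proof (rule span_minimal)
    show "f ` S \<subseteq> range (\<lambda>u. \<Sum>s\<in>S. scale (u s) (f s))"
    proof
      fix y assume "y \<in> f ` S"
      then obtain s where s: "s \<in> S" "y = f s" by auto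
      have "(\<Sum>t\<in>S. scale (if t = s then 1 else 0) (f t)) = (\<Sum>t\<in>S. if t = s then f t else 0)"
        by (rule sum.cong) auto
      then have "y = (\<Sum>t\<in>S. scale (if t = s then 1 else 0) (f t))"
        using s assms by simp
      then show "y \<in> range (\<lambda>u. \<Sum>s\<in>S. scale (u s) (f s))"
        by (rule image_eqI[where x = "\<lambda>t. if t = s then 1 else 0"]) simp
    qed
    show "subspace (range (\<lambda>u. \<Sum>s\<in>S. scale (u s) (f s)))"
    proof (rule subspaceI)
      show "0 \<in> range (\<lambda>u. \<Sum>s\<in>S. scale (u s) (f s))"
        by (rule image_eqI[where x = "\<lambda>_. 0"]) auto
    next
      fix x y
      assume "x \<in> range (\<lambda>u. \<Sum>s\<in>S. scale (u s) (f s))" "y \<in> range (\<lambda>u. \<Sum>s\<in>S. scale (u s) (f s))"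
      then obtain u v where "x = (\<Sum>s\<in>S. scale (u s) (f s))" "y = (\<Sum>s\<in>S. scale (v s) (f s))"
        by auto
      then have "x + y = (\<Sum>s\<in>S. scale (u s + v s) (f s))"
        by (simp add: scale_left_distrib sum.distrib)
      then show "x + y \<in> range (\<lambda>u. \<Sum>s\<in>S. scale (u s) (f s))"
        by (rule image_eqI[where x = "\<lambda>s. u s + v s"]) simp
    next
      fix c x assume "x \<in> range (\<lambda>u. \<Sum>s\<in>S. scale (u s) (f s))"
      then obtain u where "x = (\<Sum>s\<in>S. scale (u s) (f s))" by auto
      then have "scale c x = (\<Sum>s\<in>S. scale (c * u s) (f s))"
        by (simp add: scale_sum_right)
      then show "scale c x \<in> range (\<lambda>u. \<Sum>s\<in>S. scale (u s) (f s))"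
        by (rule image_eqI[where x = "\<lambda>s. c * u s"]) simp
    qed
  qed
  show "range (\<lambda>u. \<Sum>s\<in>S. scale (u s) (f s)) \<subseteq> span (f ` S)"
    by (auto intro!: span_family_sum)
qed

lemma in_span_family_remove:
  assumes "finite S" "(\<Sum>s\<in>S. scale (u s) (f s)) = 0" "t \<in> S" "u t \<noteq> 0"
  shows "f t \<in> span (f ` (S - {t}))"
proof -
  have "scale (u t) (f t) + (\<Sum>s\<in>S-{t}. scale (u s) (f s)) = 0"
    using assms by (simp add: sum.remove)
  then have "scale (u t) (f t) = - (\<Sum>s\<in>S-{t}. scale (u s) (f s))"
    by (simp add: eq_neg_iff_add_eq_0)
  moreover have "f t = scale (inverse (u t)) (scale (u t) (f t))"
    using assms by simp
  ultimately have "f t = scale (inverse (u t)) (- (\<Sum>s\<in>S-{t}. scale (u s) (f s)))"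
    by simp
  also have "\<dots> \<in> span (f ` (S - {t}))"
    by (rule span_scale, rule span_neg, rule span_family_sum)
  finally show ?thesis .
qed

text \<open>Independence is a property of sets, so for a family the coefficient criterion also has
  to give injectivity: two equal members would satisfy a relation with coefficients 1 and
  -1.\<close>

lemma independent_family:
  assumes fin: "finite S"
    and ind: "\<And>u s. (\<Sum>t\<in>S. scale (u t) (f t)) = 0 \<Longrightarrow> s \<in> S \<Longrightarrow> u s = 0"
  shows "inj_on f S" "independent (f ` S)"
proof -
  show inj: "inj_on f S"
  proof (rule inj_onI, rule ccontr)
    fix s t assume st: "s \<in> S" "t \<in> S" "f s = f t" "s \<noteq> t"
    define u :: "'c \<Rightarrow> 'a" where "u = (\<lambda>x. if x = s then 1 else if x = t then -1 else 0)"
    have "(\<Sum>x\<in>S. scale (u x) (f x)) = (\<Sum>x\<in>{s,t}. scale (u x) (f x))"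
      by (rule sum.mono_neutral_right) (use fin st in \<open>auto simp: u_def\<close>)
    also have "\<dots> = 0" using st by (simp add: u_def)
    finally have "u s = 0" using ind st by blast
    then show False by (simp add: u_def)
  qed
  show "independent (f ` S)"
  proof (rule independent_if_scalars_zero)
    fix g x assume g: "(\<Sum>x\<in>f ` S. scale (g x) x) = 0" "x \<in> f ` S"
    then have "(\<Sum>t\<in>S. scale (g (f t)) (f t)) = 0"
      by (simp add: sum.reindex[OF inj])
    then show "g x = 0" using ind[of "\<lambda>t. g (f t)"] g(2) by auto
  qed (use fin in simp)
qed

lemma independent_card_le_dim_finite:
  assumes "finite V" "B \<subseteq> span V" "independent B"
  shows "finite B" "card B \<le> dim V"
proof -
  obtain C where C: "C \<subseteq> V" "independent C" "V \<subseteq> span C" "card C = dim V"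
    using basis_exists by blast
  have "finite C" using C(1) assms(1) finite_subset by blast
  moreover have "B \<subseteq> span C" using assms(2) C(3) by (metis order_trans span_mono span_span)
  ultimately show "finite B" "card B \<le> dim V"
    using independent_span_bound[of C B] assms(3) C(4) by auto
qed

text \<open>The family turns out to be a basis of the span of \<open>V\<close>. A member outside
  this span would extend a basis of \<open>V\<close> to more than \<open>card S\<close> independent
  vectors; a nontrivial relation would let fewer than \<open>dim V\<close> vectors span
  \<open>V\<close>.\<close>

lemma spanning_family_card_eq_dim:
  assumes fin: "finite S" "finite V" and V: "V \<subseteq> span (f ` S)" and dim: "dim V = card S"
  shows "s \<in> S \<Longrightarrow> f s \<in> span V"
    and "(\<Sum>t\<in>S. scale (u t) (f t)) = 0 \<Longrightarrow> s \<in> S \<Longrightarrow> u s = 0"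
proof -
  assume s: "s \<in> S"
  obtain B where B: "B \<subseteq> V" "independent B" "V \<subseteq> span B" "card B = dim V"
    using basis_exists by blast
  have finB: "finite B" using B(1) fin(2) finite_subset by blast
  show "f s \<in> span V"
  proof (rule ccontr)
    assume "f s \<notin> span V"
    then have ns: "f s \<notin> span B" using B(1) span_mono by blast
    then have "independent (insert (f s) B)" using B(2) by (rule independent_insertI)
    moreover have "insert (f s) B \<subseteq> span (f ` S)"
      using B(1) V s by (auto intro: span_base)
    ultimately have "card (insert (f s) B) \<le> card (f ` S)"
      using independent_span_bound[of "f ` S"] fin by blast
    also have "\<dots> \<le> card S" using fin by (intro card_image_le) auto
    finally show False using finB B(4) dim ns span_base[of "f s" B] by (cases "f s \<in> B") auto
  qed
next
  assume u: "(\<Sum>t\<in>S. scale (u t) (f t)) = 0" and s: "s \<in> S"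
  show "u s = 0"
  proof (rule ccontr)
    assume "u s \<noteq> 0"
    then have "f s \<in> span (f ` (S - {s}))"
      using in_span_family_remove[OF fin(1) u s] by blast
    then have "f ` S \<subseteq> span (f ` (S - {s}))"
      using s by (auto intro: span_base)
    then have "V \<subseteq> span (f ` (S - {s}))"
      using V by (metis order_trans span_mono span_span)
    then have "dim V \<le> card (f ` (S - {s}))" using fin by (intro dim_le_card) auto
    also have "\<dots> \<le> card (S - {s})" using fin by (intro card_image_le) auto
    also have "\<dots> < card S" using fin(1) s by (rule card_Diff1_less)
    finally show False using dim by simp
  qed
qed

end

section \<open>Ranks of matrices indexed by a finite set\<close>

lemma sum_apply_fun: "(\<Sum>a\<in>A. f a) x = (\<Sum>a\<in>A. f a x)"
  by (induction A rule: infinite_finite_induct) auto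

interpretation cfun: vector_space cfun_scale
  by (rule vector_space_cfun_scale)

definition column_on :: "'i set \<Rightarrow> ('i \<Rightarrow> 'i \<Rightarrow> complex) \<Rightarrow> 'i \<Rightarrow> 'i \<Rightarrow> complex" where
  "column_on I A b = (\<lambda>a. if a \<in> I then A a b else 0)"

lemma rank_on_column: "rank_on I A = cfun.dim (column_on I A ` I)"
  by (simp add: rank_on_def column_on_def)

lemma rank_on_cong:
  assumes "\<And>a b. a \<in> I \<Longrightarrow> b \<in> I \<Longrightarrow> A a b = B a b"
  shows "rank_on I A = rank_on I B"
  unfolding rank_on_def
  by (rule arg_cong[where f = cfun.dim], rule image_cong) (auto simp: fun_eq_iff assms)

context
  fixes I :: "'i set" and S :: "'s set" and A :: "'i \<Rightarrow> 'i \<Rightarrow> complex" and x y :: "'s \<Rightarrow> 'i \<Rightarrow> complex"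
  assumes fin: "finite I" "finite S"
    and A: "\<And>a b. a \<in> I \<Longrightarrow> b \<in> I \<Longrightarrow> A a b = (\<Sum>s\<in>S. x s a * y s b)"
begin

private definition z :: "'s \<Rightarrow> 'i \<Rightarrow> complex" where "z s = (\<lambda>a. if a \<in> I then x s a else 0)"

private lemma column_sum: "b \<in> I \<Longrightarrow> column_on I A b = (\<Sum>s\<in>S. cfun_scale (y s b) (z s))"
  by (auto simp: column_on_def z_def cfun_scale_def fun_eq_iff A sum_apply_fun mult.commute
      intro!: sum.cong)

private lemma columns_span: "column_on I A ` I \<subseteq> cfun.span (z ` S)"
  by (auto simp: column_sum intro!: cfun.span_family_sum)

lemma rank_on_sum_le: "rank_on I A \<le> card S"
proof -
  have "rank_on I A \<le> card (z ` S)"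
    unfolding rank_on_column using columns_span fin by (intro cfun.dim_le_card) auto
  also have "\<dots> \<le> card S" using fin by (intro card_image_le)
  finally show ?thesis .
qed

text \<open>Full rank makes the left factors \<open>z s\<close> independent and puts them into the
  column space; writing \<open>z t\<close> through columns and comparing coefficients gives the dual
  vectors. For a moment matrix, \<open>y s b\<close> is the value of a monomial at an atom, and
  \<open>L t\<close> is the coefficient vector of an interpolation polynomial.\<close>

lemma rank_on_sum_eq_dual:
  assumes "rank_on I A = card S"
  obtains L where "\<And>s t. s \<in> S \<Longrightarrow> t \<in> S \<Longrightarrow> (\<Sum>b\<in>I. y s b * L t b) = (if s = t then 1 else 0)"
proof -
  note * = cfun.spanning_family_card_eq_dim[OF fin(2) _ columns_span]
  have "\<forall>t\<in>S. \<exists>L. z t = (\<Sum>b\<in>I. cfun_scale (L b) (column_on I A b))"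
  proof
    fix t assume "t \<in> S"
    then have "z t \<in> cfun.span (column_on I A ` I)"
      using * fin assms by (simp add: rank_on_column)
    then show "\<exists>L. z t = (\<Sum>b\<in>I. cfun_scale (L b) (column_on I A b))"
      unfolding cfun.span_finite_image[OF fin(1)] by auto
  qed
  then obtain L where L: "\<And>t. t \<in> S \<Longrightarrow> z t = (\<Sum>b\<in>I. cfun_scale (L t b) (column_on I A b))"
    by metis
  have "(\<Sum>b\<in>I. y s b * L t b) = (if s = t then 1 else 0)" if st: "s \<in> S" "t \<in> S" for s t
  proof -
    have "z t = (\<Sum>b\<in>I. cfun_scale (L t b) (\<Sum>s\<in>S. cfun_scale (y s b) (z s)))"
      using st by (simp add: L column_sum)
    also have "\<dots> = (\<Sum>s\<in>S. cfun_scale (\<Sum>b\<in>I. y s b * L t b) (z s))"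
      by (simp add: cfun.scale_sum_right cfun.scale_sum_left mult.commute sum.swap[of _ S I])
    finally have 1: "z t = (\<Sum>s\<in>S. cfun_scale (\<Sum>b\<in>I. y s b * L t b) (z s))" .
    have "z t = (\<Sum>s\<in>S. if s = t then z s else 0)" using st fin by simp
    also have "\<dots> = (\<Sum>s\<in>S. cfun_scale (if s = t then 1 else 0) (z s))"
      by (rule sum.cong) auto
    finally have "(\<Sum>s\<in>S. cfun_scale ((\<Sum>b\<in>I. y s b * L t b) - (if s = t then 1 else 0)) (z s)) = 0"
      using 1 by (simp add: cfun.scale_left_diff_distrib sum_subtractf)
    then have "(\<Sum>b\<in>I. y s b * L t b) - (if s = t then 1 else 0) = 0"
      using *(2)[of "\<lambda>s. (\<Sum>b\<in>I. y s b * L t b) - (if s = t then 1 else 0)" s] fin st assms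
      by (simp add: rank_on_column)
    then show ?thesis by simp
  qed
  then show ?thesis using that by blast
qed

text \<open>The vectors \<open>L t\<close> recover each \<open>z t\<close> as a combination of
  columns, and pairing a relation with \<open>L' s\<close> isolates its coefficient at
  \<open>s\<close>. Thus the column space contains \<open>card S\<close> independent
  vectors.\<close>

lemma rank_on_sum_eq:
  assumes L: "\<And>s t. s \<in> S \<Longrightarrow> t \<in> S \<Longrightarrow> (\<Sum>b\<in>I. y s b * L t b) = (if s = t then 1 else 0)"
    and L': "\<And>s t. s \<in> S \<Longrightarrow> t \<in> S \<Longrightarrow> (\<Sum>a\<in>I. x s a * L' t a) = (if s = t then 1 else 0)"
  shows "rank_on I A = card S"
proof (rule antisym[OF rank_on_sum_le])
  have zspan: "z t \<in> cfun.span (column_on I A ` I)" if t: "t \<in> S" for t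
  proof -
    have "(\<Sum>b\<in>I. cfun_scale (L t b) (column_on I A b)) =
        (\<Sum>s\<in>S. cfun_scale (\<Sum>b\<in>I. y s b * L t b) (z s))"
      by (simp add: column_sum cfun.scale_sum_right cfun.scale_sum_left mult.commute sum.swap[of _ S I])
    also have "\<dots> = (\<Sum>s\<in>S. if s = t then z s else 0)"
      using t by (intro sum.cong) (auto simp: L)
    also have "\<dots> = z t" using t fin by simp
    finally have eq: "(\<Sum>b\<in>I. cfun_scale (L t b) (column_on I A b)) = z t" .
    have "(\<Sum>b\<in>I. cfun_scale (L t b) (column_on I A b)) \<in> cfun.span (column_on I A ` I)"
      by (rule cfun.span_family_sum)
    then show ?thesis by (simp only: eq)
  qed
  have ind: "u s = 0" if u: "(\<Sum>t\<in>S. cfun_scale (u t) (z t)) = 0" and s: "s \<in> S" for u s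
  proof -
    have "0 = (\<Sum>a\<in>I. (\<Sum>t\<in>S. cfun_scale (u t) (z t)) a * L' s a)" by (simp add: u)
    also have "\<dots> = (\<Sum>a\<in>I. \<Sum>t\<in>S. u t * (x t a * L' s a))"
      by (intro sum.cong) (auto simp: sum_apply_fun cfun_scale_def z_def sum_distrib_right mult.assoc)
    also have "\<dots> = (\<Sum>t\<in>S. u t * (\<Sum>a\<in>I. x t a * L' s a))"
      by (subst sum.swap) (simp add: sum_distrib_left)
    also have "\<dots> = (\<Sum>t\<in>S. if t = s then u t else 0)"
      using s by (intro sum.cong) (auto simp: L')
    also have "\<dots> = u s" using s fin by simp
    finally show ?thesis by simp
  qed
  have fam: "inj_on z S" "cfun.independent (z ` S)"
    by (rule cfun.independent_family[OF fin(2)], rule ind, assumption+)+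
  have "card (z ` S) \<le> rank_on I A"
    unfolding rank_on_column
    by (rule cfun.independent_card_le_dim_finite(2)) (use fin fam zspan in auto)
  then show "card S \<le> rank_on I A" using fam(1) by (simp add: card_image)
qed

end

text \<open>Columns that are independent in the rows of \<open>J\<close> remain so in the rows of
  \<open>I\<close>, because a relation between long columns restricts to \<open>J\<close>. With
  equal ranks, a column basis of the corner is already maximal among all columns, so the columns in
  \<open>J\<close> generate the others.\<close>

lemma rank_on_subset_eq_columns:
  assumes fin: "finite I" and J: "J \<subseteq> I" and rank: "rank_on I A = rank_on J A" and b: "b \<in> I"
  obtains L where "\<And>a. a \<in> I \<Longrightarrow> A a b = (\<Sum>c\<in>J. A a c * L c)"
proof -
  have finJ: "finite J" using fin J finite_subset by blast
  obtain C where C: "C \<subseteq> column_on J A ` J" "cfun.independent C"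
      "column_on J A ` J \<subseteq> cfun.span C" "card C = rank_on J A"
    using cfun.basis_exists[of "column_on J A ` J"] unfolding rank_on_column by blast
  obtain B where B: "B \<subseteq> J" "inj_on (column_on J A) B" "C = column_on J A ` B"
    using C(1) by (auto simp: subset_image_inj)
  have finB: "finite B" using B(1) finJ finite_subset by blast
  have ind: "u s = 0" if u: "(\<Sum>t\<in>B. cfun_scale (u t) (column_on I A t)) = 0" and s: "s \<in> B" for u s
  proof -
    have "(\<Sum>t\<in>B. cfun_scale (u t) (column_on J A t)) a = 0" for a
    proof (cases "a \<in> J")
      case True
      then have "(\<Sum>t\<in>B. cfun_scale (u t) (column_on J A t)) a =
          (\<Sum>t\<in>B. cfun_scale (u t) (column_on I A t)) a"
        using J by (auto simp: sum_apply_fun cfun_scale_def column_on_def)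
      then show ?thesis by (simp add: u)
    qed (simp add: sum_apply_fun cfun_scale_def column_on_def)
    then have "(\<Sum>t\<in>B. cfun_scale (u t) (column_on J A t)) = 0" by (simp add: fun_eq_iff)
    then have "(\<Sum>v\<in>C. cfun_scale (u (the_inv_into B (column_on J A) v)) v) = 0"
      by (simp add: B(3) sum.reindex[OF B(2)] the_inv_into_f_f[OF B(2)])
    then have "u (the_inv_into B (column_on J A) (column_on J A s)) = 0"
      using cfun.independentD[OF C(2), of C "\<lambda>v. u (the_inv_into B (column_on J A) v)" "column_on J A s"]
        finB B(3) s by blast
    then show ?thesis using s by (simp add: the_inv_into_f_f[OF B(2)])
  qed
  have fam: "inj_on (column_on I A) B" "cfun.independent (column_on I A ` B)"
    by (rule cfun.independent_family[OF finB], rule ind, assumption+)+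
  have cardB: "card (column_on I A ` B) = rank_on J A"
    using fam(1) C(4) B(2,3) by (simp add: card_image)
  have "column_on I A b \<in> cfun.span (column_on I A ` B)"
  proof (rule ccontr)
    assume n: "column_on I A b \<notin> cfun.span (column_on I A ` B)"
    then have "cfun.independent (insert (column_on I A b) (column_on I A ` B))"
      using fam(2) by (rule cfun.independent_insertI)
    then have "card (insert (column_on I A b) (column_on I A ` B)) \<le> rank_on I A"
      unfolding rank_on_column
      by (intro cfun.independent_card_le_dim_finite(2)) (use fin b B(1) J in \<open>auto intro!: cfun.span_base\<close>)
    moreover have "column_on I A b \<notin> column_on I A ` B" using n cfun.span_base by blast
    ultimately show False using finB cardB rank by simp
  qed
  then have "column_on I A b \<in> cfun.span (column_on I A ` J)"
    using B(1) by (meson cfun.span_mono image_mono subsetD)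
  then obtain L where L: "column_on I A b = (\<Sum>c\<in>J. cfun_scale (L c) (column_on I A c))"
    unfolding cfun.span_finite_image[OF finJ] by (rule rangeE)
  show ?thesis
  proof (rule that)
    fix a assume a: "a \<in> I"
    then have "A a b = column_on I A b a" by (simp add: column_on_def)
    also have "\<dots> = (\<Sum>c\<in>J. A a c * L c)"
      unfolding L using a by (auto simp: sum_apply_fun cfun_scale_def column_on_def mult.commute)
    finally show "A a b = (\<Sum>c\<in>J. A a c * L c)" .
  qed
qed

section \<open>Common eigenvectors of commuting operators over the complex numbers\<close>

locale complex_vector_space = vector_space scale
  for scale :: "complex \<Rightarrow> 'v::ab_group_add \<Rightarrow> 'v" (infixr "*c" 75)
begin

context
  fixes C :: "'v set" and T :: "'v \<Rightarrow> 'v"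
  assumes sub: "subspace C"
    and maps: "\<And>x. x \<in> C \<Longrightarrow> T x \<in> C"
    and add: "\<And>x y. x \<in> C \<Longrightarrow> y \<in> C \<Longrightarrow> T (x + y) = T x + T y"
    and scl: "\<And>c x. x \<in> C \<Longrightarrow> T (c *c x) = c *c T x"
begin

private definition ev :: "complex poly \<Rightarrow> 'v \<Rightarrow> 'v" where
  "ev p v = (\<Sum>k\<le>degree p. coeff p k *c (T ^^ k) v)"

private lemma ev_le: "degree p \<le> n \<Longrightarrow> ev p v = (\<Sum>k\<le>n. coeff p k *c (T ^^ k) v)"
  unfolding ev_def by (rule sum.mono_neutral_left) (auto simp: coeff_eq_0)

private lemma pow_in: "v \<in> C \<Longrightarrow> (T ^^ k) v \<in> C"
  by (induction k) (auto intro: maps)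

private lemma ev_in: "v \<in> C \<Longrightarrow> ev p v \<in> C"
  unfolding ev_def by (intro subspace_sum[OF sub] subspace_scale[OF sub] pow_in)

private lemma T_zero: "T 0 = 0"
  using scl[of 0 0] subspace_0[OF sub] by simp

private lemma T_sum: "finite S \<Longrightarrow> (\<And>s. s \<in> S \<Longrightarrow> f s \<in> C) \<Longrightarrow> T (\<Sum>s\<in>S. f s) = (\<Sum>s\<in>S. T (f s))"
  by (induction S rule: finite_induct) (auto simp: T_zero add subspace_sum[OF sub])

private lemma ev_linear_mult:
  assumes v: "v \<in> C"
  shows "ev ([:- z, 1:] * q) v = T (ev q v) - z *c ev q v"
proof -
  let ?n = "degree q"
  have "degree ([:- z, 1:] * q) \<le> Suc ?n"
    using degree_mult_le[of "[:- z, 1:]" q] by simp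
  then have "ev ([:- z, 1:] * q) v = (\<Sum>k\<le>Suc ?n. coeff ([:- z, 1:] * q) k *c (T ^^ k) v)"
    by (rule ev_le)
  also have "\<dots> = (\<Sum>k\<le>Suc ?n. coeff (pCons 0 q) k *c (T ^^ k) v) -
      (\<Sum>k\<le>Suc ?n. z *c coeff q k *c (T ^^ k) v)"
    by (simp add: mult_pCons_left scale_left_distrib scale_left_diff_distrib sum_subtractf
        del: sum.atMost_Suc)
  also have "(\<Sum>k\<le>Suc ?n. coeff (pCons 0 q) k *c (T ^^ k) v) = (\<Sum>k\<le>?n. coeff q k *c T ((T ^^ k) v))"
    by (subst sum.atMost_Suc_shift) simp
  also have "\<dots> = T (ev q v)"
    unfolding ev_def
    by (subst T_sum) (auto simp: scl pow_in v intro!: subspace_scale[OF sub])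
  also have "(\<Sum>k\<le>Suc ?n. z *c coeff q k *c (T ^^ k) v) = z *c ev q v"
    by (simp add: ev_le[of q "Suc ?n"] scale_sum_right del: sum.atMost_Suc)
  finally show ?thesis .
qed

text \<open>Here \<open>ev p v\<close> is p(T) v. With a root z of p and p = (X - z) q, either q(T)
  v is an eigenvector for z, or it vanishes and q annihilates \<open>v\<close> in lower
  degree.\<close>

private lemma eigenvector_of_annihilator:
  "p \<noteq> 0 \<Longrightarrow> v \<in> C \<Longrightarrow> v \<noteq> 0 \<Longrightarrow> ev p v = 0 \<Longrightarrow> \<exists>w\<in>C. w \<noteq> 0 \<and> (\<exists>c. T w = c *c w)"
proof (induction "degree p" arbitrary: p)
  case 0
  then obtain c where c: "p = [:c:]" by (metis degree_eq_zeroE)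
  then have "c *c v = 0" using 0 by (simp add: ev_def)
  then show ?case using c 0 by simp
next
  case (Suc d)
  then have "\<not> constant (poly p)" by (metis constant_degree nat.distinct(1))
  then obtain z where "poly p z = 0" using fundamental_theorem_of_algebra by blast
  then obtain q where q: "p = [:- z, 1:] * q" by (metis dvdE poly_eq_0_iff_dvd)
  have q0: "q \<noteq> 0" using q Suc.prems by auto
  then have dq: "degree q = d" using Suc.hyps(2) q by (simp add: degree_mult_eq del: mult_pCons_left)
  show ?case
  proof (cases "ev q v = 0")
    case True
    then show ?thesis using Suc.hyps(1)[of q] dq q0 Suc.prems by blast
  next
    case False
    have "T (ev q v) = z *c ev q v"
      using ev_linear_mult[of v z q] Suc.prems q by simp
    then show ?thesis using False ev_in Suc.prems by blast
  qed
qed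

text \<open>The \<open>card B + 1\<close> iterates of \<open>v\<close> lie in the span of
  \<open>card B\<close> vectors, so they satisfy a nontrivial relation, whose coefficients form a
  nonzero polynomial annihilating \<open>v\<close>.\<close>

lemma eigenvector_exists:
  assumes fin: "C \<subseteq> span B" "finite B" and v: "v \<in> C" "v \<noteq> 0"
  shows "\<exists>w\<in>C. w \<noteq> 0 \<and> (\<exists>c. T w = c *c w)"
proof -
  have "\<exists>u. (\<Sum>k\<le>card B. u k *c (T ^^ k) v) = 0 \<and> (\<exists>k\<le>card B. u k \<noteq> 0)"
  proof (rule ccontr)
    assume "\<not> ?thesis"
    then have ind: "u k = 0" if "(\<Sum>k\<le>card B. u k *c (T ^^ k) v) = 0" "k \<in> {..card B}" for u k
      using that by auto
    have fam: "inj_on (\<lambda>k. (T ^^ k) v) {..card B}" "independent ((\<lambda>k. (T ^^ k) v) ` {..card B})"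
      by (rule independent_family, simp, rule ind, assumption+)+
    have "(\<lambda>k. (T ^^ k) v) ` {..card B} \<subseteq> span B" using fin(1) pow_in[OF v(1)] by blast
    then have "card ((\<lambda>k. (T ^^ k) v) ` {..card B}) \<le> card B"
      using independent_span_bound[OF fin(2) fam(2)] by blast
    then show False using fam(1) by (simp add: card_image)
  qed
  then obtain u k where u: "(\<Sum>k\<le>card B. u k *c (T ^^ k) v) = 0" and k: "k \<le> card B" "u k \<noteq> 0"
    by blast
  define p where "p = (\<Sum>k\<le>card B. monom (u k) k)"
  have coeff: "coeff p j = (if j \<le> card B then u j else 0)" for j
    by (simp add: p_def coeff_sum)
  have "degree p \<le> card B" by (rule degree_le) (simp add: coeff)
  then have "ev p v = 0" by (simp add: ev_le coeff u)
  moreover have "p \<noteq> 0" using k coeff[of k] by auto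
  ultimately show ?thesis using eigenvector_of_annihilator v by blast
qed

end

text \<open>The joint eigenspace of the operators already treated is invariant under the next one by
  commutativity. Linearity is asked for on \<open>C\<close> alone because \<open>mult_op\<close>
  works with chosen representatives and is meaningful only on a column space.\<close>

lemma common_eigenvector:
  assumes "finite U" and "subspace C" and "C \<subseteq> span B" "finite B" and v: "v \<in> C" "v \<noteq> 0"
    and maps: "\<And>u x. u \<in> U \<Longrightarrow> x \<in> C \<Longrightarrow> T u x \<in> C"
    and add: "\<And>u x y. u \<in> U \<Longrightarrow> x \<in> C \<Longrightarrow> y \<in> C \<Longrightarrow> T u (x + y) = T u x + T u y"
    and scl: "\<And>u c x. u \<in> U \<Longrightarrow> x \<in> C \<Longrightarrow> T u (c *c x) = c *c T u x"
    and comm: "\<And>u u' x. u \<in> U \<Longrightarrow> u' \<in> U \<Longrightarrow> x \<in> C \<Longrightarrow> T u (T u' x) = T u' (T u x)"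
  obtains w l where "w \<in> C" "w \<noteq> 0" "\<And>u. u \<in> U \<Longrightarrow> T u w = l u *c w"
proof -
  have "\<exists>w\<in>C. w \<noteq> 0 \<and> (\<exists>l. \<forall>u\<in>U. T u w = l u *c w)"
    using assms(1) maps add scl comm
  proof (induction U rule: finite_induct)
    case empty
    then show ?case using v by auto
  next
    case (insert a U)
    have "\<exists>w\<in>C. w \<noteq> 0 \<and> (\<exists>l. \<forall>u\<in>U. T u w = l u *c w)"
      by (rule insert.IH; rule insert.prems; simp)
    then obtain w l where w: "w \<in> C" "w \<noteq> 0" "\<forall>u\<in>U. T u w = l u *c w" by blast
    define D where "D = {x\<in>C. \<forall>u\<in>U. T u x = l u *c x}"
    have D: "subspace D"
    proof (rule subspaceI)
      have "T u 0 = 0" if "u \<in> U" for u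
        using insert.prems(3)[of u 0 0] subspace_0[OF \<open>subspace C\<close>] that by simp
      then show "0 \<in> D"
        using subspace_0[OF \<open>subspace C\<close>] by (simp add: D_def)
    next
      fix x y assume "x \<in> D" "y \<in> D"
      then show "x + y \<in> D"
        using insert.prems(2) subspace_add[OF \<open>subspace C\<close>] by (simp add: D_def scale_right_distrib)
    next
      fix c x assume "x \<in> D"
      then show "c *c x \<in> D"
        using insert.prems(3) subspace_scale[OF \<open>subspace C\<close>] by (simp add: D_def mult.commute)
    qed
    have "\<exists>w\<in>D. w \<noteq> 0 \<and> (\<exists>c. T a w = c *c w)"
    proof (rule eigenvector_exists[OF D])
      fix x assume x: "x \<in> D"
      then have xC: "x \<in> C" by (simp add: D_def)
      have "T u (T a x) = l u *c T a x" if u: "u \<in> U" for u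
      proof -
        have "T u (T a x) = T a (T u x)" using insert.prems(4) u xC by blast
        also have "\<dots> = T a (l u *c x)" using x u by (simp add: D_def)
        also have "\<dots> = l u *c T a x" using insert.prems(3) xC by blast
        finally show ?thesis .
      qed
      then show "T a x \<in> D" using insert.prems(1) xC by (simp add: D_def)
    next
      show "T a (x + y) = T a x + T a y" if "x \<in> D" "y \<in> D" for x y
        using that by (auto simp: D_def intro!: insert.prems(2))
      show "T a (c *c x) = c *c T a x" if "x \<in> D" for c x
        using that by (auto simp: D_def intro!: insert.prems(3))
      show "D \<subseteq> span B" using \<open>C \<subseteq> span B\<close> by (auto simp: D_def)
      show "w \<in> D" using w by (simp add: D_def)
    qed (use w \<open>finite B\<close> in auto)
    then obtain w' c where w': "w' \<in> D" "w' \<noteq> 0" "T a w' = c *c w'" by blast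
    then have "\<forall>u\<in>insert a U. T u w' = (l(a := c)) u *c w'"
      using insert.hyps by (auto simp: D_def)
    then show ?case using w' unfolding D_def by blast
  qed
  then show ?thesis using that by blast
qed

end

interpretation cfun: complex_vector_space cfun_scale
  by unfold_locales

section \<open>Polynomials in $z$ and $\bar z$\<close>

lemma mdeg_add: "mdeg (a + b) = mdeg a + mdeg b"
  by (simp add: mdeg_def sum.distrib)

lemma mdeg_zero [simp]: "mdeg 0 = 0"
  by (simp add: mdeg_def)

lemma mdeg_swap [simp]: "mdeg (prod.swap a) = mdeg a"
  by (simp add: mdeg_def)

lemma swap_add: "prod.swap (a + b) = prod.swap a + prod.swap b" for a b :: "'d::finite mono"
  by (simp add: prod_eq_iff)

lemma mono_eval_add: "mono_eval (a + b) z = mono_eval a z * mono_eval b z"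
  by (simp add: mono_eval_def power_add prod.distrib)

lemma mono_eval_zero [simp]: "mono_eval 0 z = 1"
  by (simp add: mono_eval_def)

lemma mono_eval_swap: "mono_eval (prod.swap a) z = cnj (mono_eval a z)"
  by (simp add: mono_eval_def mult.commute)

lemma mono_eval_axis: "mono_eval (0, axis t 1) z = z $ t"
proof -
  have "(z $ s) ^ (axis t 1 $ s) = (if s = t then z $ t else 1)" for s
    by (simp add: axis_def)
  then have "mono_eval (0, axis t 1) z = (\<Prod>s\<in>UNIV. if s = t then z $ t else 1)"
    unfolding mono_eval_def by simp
  then show ?thesis by simp
qed

lemma mdeg_axis: "mdeg (axis t 1, 0) = 1" "mdeg (0, axis t 1) = 1"
proof -
  have "(\<Sum>s\<in>UNIV. axis t (1::nat) $ s) = (\<Sum>s\<in>UNIV. if s = t then 1 else 0)"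
    by (rule sum.cong) (auto simp: axis_def)
  also have "\<dots> = 1" by simp
  finally have *: "(\<Sum>s\<in>UNIV. axis t (1::nat) $ s) = 1" .
  show "mdeg (axis t 1, 0) = 1" "mdeg (0, axis t 1) = 1"
    by (simp_all only: mdeg_def fst_conv snd_conv *) simp_all
qed

lemma zpoly_eval_riesz: "zpoly_eval p z = riesz (\<lambda>a. mono_eval a z) p"
  by (simp add: zpoly_eval_def riesz_def)

lemma zpoly_sum_single:
  "finite I \<Longrightarrow> Poly_Mapping.keys p \<subseteq> I \<Longrightarrow> p = (\<Sum>a\<in>I. Poly_Mapping.single a (Poly_Mapping.lookup p a))"
  for p :: "'d::finite zpoly"
  by (rule poly_mapping_eqI) (auto simp: lookup_sum lookup_single when_def in_keys_iff)

lemma riesz_single [simp]: "riesz \<gamma> (Poly_Mapping.single a c) = c * \<gamma> a"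
  by (subst riesz_superset[of "{a}"]) auto

lemma riesz_zero [simp]: "riesz \<gamma> 0 = 0"
  by (simp add: riesz_def)

lemma riesz_uminus: "riesz \<gamma> (- q) = - riesz \<gamma> q"
  using riesz_add[of \<gamma> q "- q"] by (simp add: eq_neg_iff_add_eq_0 add.commute)

lemma riesz_diff: "riesz \<gamma> (q - q') = riesz \<gamma> q - riesz \<gamma> q'"
  using riesz_add[of \<gamma> q "- q'"] by (simp add: riesz_uminus)

lemma zpoly_mult_expand:
  "p * q = (\<Sum>a\<in>Poly_Mapping.keys p. \<Sum>b\<in>Poly_Mapping.keys q.
     Poly_Mapping.single (a + b) (Poly_Mapping.lookup p a * Poly_Mapping.lookup q b))"
  for p q :: "'d::finite zpoly"
proof -
  have "p * q = (\<Sum>a\<in>Poly_Mapping.keys p. Poly_Mapping.single a (Poly_Mapping.lookup p a)) *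
     (\<Sum>b\<in>Poly_Mapping.keys q. Poly_Mapping.single b (Poly_Mapping.lookup q b))"
    using zpoly_sum_single[of "Poly_Mapping.keys p" p] zpoly_sum_single[of "Poly_Mapping.keys q" q]
    by simp
  then show ?thesis by (simp add: sum_product mult_single)
qed

lemma zpoly_eval_one [simp]: "zpoly_eval 1 z = 1"
  unfolding zpoly_eval_riesz by (simp flip: single_one)

lemma zpoly_eval_single [simp]: "zpoly_eval (Poly_Mapping.single a c) z = c * mono_eval a z"
  by (simp add: zpoly_eval_riesz)

lemma zpoly_eval_diff: "zpoly_eval (p - q) z = zpoly_eval p z - zpoly_eval q z"
  by (simp add: zpoly_eval_riesz riesz_diff)

lemma zpoly_eval_sum: "zpoly_eval (\<Sum>x\<in>X. q x) z = (\<Sum>x\<in>X. zpoly_eval (q x) z)"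
  by (simp add: zpoly_eval_riesz riesz_sum)

lemma zpoly_eval_mult: "zpoly_eval (p * q) z = zpoly_eval p z * zpoly_eval q z"
proof -
  have "zpoly_eval (p * q) z = (\<Sum>a\<in>Poly_Mapping.keys p. \<Sum>b\<in>Poly_Mapping.keys q.
     (Poly_Mapping.lookup p a * mono_eval a z) * (Poly_Mapping.lookup q b * mono_eval b z))"
    by (simp add: zpoly_mult_expand[of p q] zpoly_eval_sum mono_eval_add mult_ac)
  then show ?thesis by (simp add: zpoly_eval_def sum_product)
qed

lemma lookup_zpoly_conj: "Poly_Mapping.lookup (zpoly_conj f) a = cnj (Poly_Mapping.lookup f (prod.swap a))"
proof -
  have "Poly_Mapping.lookup (zpoly_conj f) a =
      (\<Sum>b\<in>Poly_Mapping.keys f. if b = prod.swap a then cnj (Poly_Mapping.lookup f b) else 0)"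
    unfolding zpoly_conj_def lookup_sum lookup_single when_def
    by (rule sum.cong) auto
  also have "\<dots> = cnj (Poly_Mapping.lookup f (prod.swap a))"
    by (simp add: in_keys_iff)
  finally show ?thesis .
qed

lemma zpoly_conj_add: "zpoly_conj (f + g) = zpoly_conj f + zpoly_conj g"
  by (rule poly_mapping_eqI) (simp add: lookup_zpoly_conj lookup_add)

lemma zpoly_conj_zero [simp]: "zpoly_conj 0 = 0"
  by (rule poly_mapping_eqI) (simp add: lookup_zpoly_conj)

lemma zpoly_conj_diff: "zpoly_conj (f - g) = zpoly_conj f - zpoly_conj g"
  by (rule poly_mapping_eqI) (simp add: lookup_zpoly_conj lookup_minus)

lemma zpoly_conj_sum: "zpoly_conj (\<Sum>x\<in>X. f x) = (\<Sum>x\<in>X. zpoly_conj (f x))"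
  by (induction X rule: infinite_finite_induct) (auto simp: zpoly_conj_add)

lemma zpoly_conj_conj [simp]: "zpoly_conj (zpoly_conj f) = f"
  by (rule poly_mapping_eqI) (simp add: lookup_zpoly_conj)

lemma zpoly_conj_single [simp]:
  "zpoly_conj (Poly_Mapping.single a c) = Poly_Mapping.single (prod.swap a) (cnj c)"
  by (rule poly_mapping_eqI, simp add: lookup_zpoly_conj lookup_single when_def) (metis swap_swap)

lemma swap_zero [simp]: "prod.swap (0 :: 'd::finite mono) = 0"
  by (simp add: zero_prod_def)

lemma zpoly_conj_mult: "zpoly_conj (f * g) = zpoly_conj f * zpoly_conj g"
proof -
  let ?c = "\<lambda>f. \<Sum>a\<in>Poly_Mapping.keys f. Poly_Mapping.single (prod.swap a) (cnj (Poly_Mapping.lookup f a))"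
  have "zpoly_conj f * zpoly_conj g = ?c f * ?c g"
    by (simp add: zpoly_conj_def)
  then show ?thesis
    by (simp add: zpoly_mult_expand[of f g] zpoly_conj_sum sum_product mult_single swap_add)
qed

lemma zpoly_eval_conj: "zpoly_eval (zpoly_conj f) z = cnj (zpoly_eval f z)"
  unfolding zpoly_conj_def zpoly_eval_sum
  by (simp add: zpoly_eval_def[of f] mono_eval_swap)

section \<open>Polynomials of bounded degree and their coefficient vectors\<close>

definition polys :: "nat \<Rightarrow> 'd::finite zpoly set" where
  "polys l = {f. Poly_Mapping.keys f \<subseteq> monomials l}"

lemma polys_mono: "l \<le> l' \<Longrightarrow> polys l \<subseteq> polys l'"
  by (auto simp: polys_def monomials_def)

lemma polys_zero [simp]: "0 \<in> polys l"
  by (simp add: polys_def)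

lemma polys_add: "f \<in> polys l \<Longrightarrow> g \<in> polys l \<Longrightarrow> f + g \<in> polys l"
  using keys_add[of f g] by (auto simp: polys_def)

lemma polys_diff: "f \<in> polys l \<Longrightarrow> g \<in> polys l \<Longrightarrow> f - g \<in> polys l"
  using keys_diff[of f g] by (auto simp: polys_def)

lemma polys_sum: "(\<And>x. x \<in> X \<Longrightarrow> f x \<in> polys l) \<Longrightarrow> (\<Sum>x\<in>X. f x) \<in> polys l"
  by (induction X rule: infinite_finite_induct) (auto intro: polys_add)

lemma polys_mult: "f \<in> polys l \<Longrightarrow> g \<in> polys l' \<Longrightarrow> f * g \<in> polys (l + l')"
proof -
  assume fg: "f \<in> polys l" "g \<in> polys l'"
  have "mdeg c \<le> l + l'" if c: "c \<in> Poly_Mapping.keys (f * g)" for c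
  proof -
    obtain a b where "c = a + b" "a \<in> Poly_Mapping.keys f" "b \<in> Poly_Mapping.keys g"
      using keys_mult[of f g] c by blast
    then show ?thesis using fg by (auto simp: polys_def monomials_def mdeg_add intro!: add_mono)
  qed
  then show "f * g \<in> polys (l + l')" by (auto simp: polys_def monomials_def)
qed

lemma polys_single: "mdeg a \<le> l \<Longrightarrow> Poly_Mapping.single a c \<in> polys l"
  by (auto simp: polys_def monomials_def)

lemma polys_const_mult: "f \<in> polys l \<Longrightarrow> Poly_Mapping.single 0 c * f \<in> polys l"
  using polys_mult[OF polys_single[of 0 0 c]] by simp

lemma polys_one [simp]: "1 \<in> polys l"
  using polys_single[of 0 l 1] by (simp add: single_one)

lemma polys_conj: "f \<in> polys l \<Longrightarrow> zpoly_conj f \<in> polys l"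
  unfolding zpoly_conj_def by (intro polys_sum polys_single) (auto simp: polys_def monomials_def)

definition zpoly_of :: "'d::finite mono set \<Rightarrow> ('d mono \<Rightarrow> complex) \<Rightarrow> 'd zpoly" where
  "zpoly_of I v = (\<Sum>b\<in>I. Poly_Mapping.single b (v b))"

lemma lookup_zpoly_of:
  "finite I \<Longrightarrow> Poly_Mapping.lookup (zpoly_of I v) b = (if b \<in> I then v b else 0)"
  by (simp add: zpoly_of_def lookup_sum lookup_single when_def)

lemma zpoly_of_polys: "zpoly_of (monomials l) v \<in> polys l"
  by (auto simp: polys_def in_keys_iff lookup_zpoly_of[OF finite_monomials] split: if_splits)

lemma zpoly_eval_polys:
  "f \<in> polys l \<Longrightarrow> zpoly_eval f z = (\<Sum>b\<in>monomials l. mono_eval b z * Poly_Mapping.lookup f b)"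
  by (simp add: zpoly_eval_riesz riesz_superset[OF finite_monomials] polys_def mult.commute)

lemma riesz_cong_polys:
  "q \<in> polys l \<Longrightarrow> (\<And>a. a \<in> monomials l \<Longrightarrow> \<sigma> a = \<tau> a) \<Longrightarrow> riesz \<sigma> q = riesz \<tau> q"
  unfolding riesz_def by (rule sum.cong) (auto simp: polys_def)

lemma psd_on_loc_entry:
  "psd_on (monomials l) (loc_entry \<tau> p) \<longleftrightarrow> (\<forall>f\<in>polys l. riesz \<tau> (p * f * zpoly_conj f) \<in> \<real>\<^sub>\<ge>\<^sub>0)"
proof
  assume A: "psd_on (monomials l) (loc_entry \<tau> p)"
  show "\<forall>f\<in>polys l. riesz \<tau> (p * f * zpoly_conj f) \<in> \<real>\<^sub>\<ge>\<^sub>0"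
    using A unfolding psd_on_def polys_def by (auto simp flip: loc_entry_riesz[OF finite_monomials])
next
  assume A: "\<forall>f\<in>polys l. riesz \<tau> (p * f * zpoly_conj f) \<in> \<real>\<^sub>\<ge>\<^sub>0"
  show "psd_on (monomials l) (loc_entry \<tau> p)"
    unfolding psd_on_def
  proof
    fix v :: "'a mono \<Rightarrow> complex"
    let ?f = "zpoly_of (monomials l) v"
    have f: "?f \<in> polys l" by (rule zpoly_of_polys)
    then have "riesz \<tau> (p * ?f * zpoly_conj ?f) \<in> \<real>\<^sub>\<ge>\<^sub>0" using A by blast
    also have "riesz \<tau> (p * ?f * zpoly_conj ?f) =
        (\<Sum>a\<in>monomials l. (\<Sum>b\<in>monomials l. loc_entry \<tau> p a b * v b) * cnj (v a))"
      using f by (subst loc_entry_riesz[OF finite_monomials, symmetric])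
        (auto simp: polys_def lookup_zpoly_of finite_monomials)
    finally show "(\<Sum>a\<in>monomials l. (\<Sum>b\<in>monomials l. loc_entry \<tau> p a b * v b) * cnj (v a)) \<in> \<real>\<^sub>\<ge>\<^sub>0" .
  qed
qed

section \<open>The form of a moment sequence and its kernel\<close>

definition mform :: "('d::finite mono \<Rightarrow> complex) \<Rightarrow> 'd zpoly \<Rightarrow> 'd zpoly \<Rightarrow> complex" where
  "mform \<tau> f g = riesz \<tau> (f * zpoly_conj g)"

lemma moment_psd_mform: "moment_psd l \<tau> \<longleftrightarrow> (\<forall>f\<in>polys l. mform \<tau> f f \<in> \<real>\<^sub>\<ge>\<^sub>0)"
  by (simp add: moment_psd_def psd_on_loc_entry mform_def)

lemma mform_add_left: "mform \<tau> (f + f') g = mform \<tau> f g + mform \<tau> f' g"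
  by (simp add: mform_def ring_distribs riesz_add)

lemma mform_diff_left: "mform \<tau> (f - f') g = mform \<tau> f g - mform \<tau> f' g"
  by (simp add: mform_def ring_distribs riesz_diff)

lemma mform_sum_left: "mform \<tau> (\<Sum>x\<in>X. f x) g = (\<Sum>x\<in>X. mform \<tau> (f x) g)"
  by (simp add: mform_def sum_distrib_right riesz_sum)

lemma mform_add_right: "mform \<tau> g (f + f') = mform \<tau> g f + mform \<tau> g f'"
  by (simp add: mform_def zpoly_conj_add ring_distribs riesz_add)

lemma mform_diff_right: "mform \<tau> g (f - f') = mform \<tau> g f - mform \<tau> g f'"
  by (simp add: mform_def zpoly_conj_diff ring_distribs riesz_diff)

lemma mform_sum_right: "mform \<tau> g (\<Sum>x\<in>X. f x) = (\<Sum>x\<in>X. mform \<tau> g (f x))"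
  by (simp add: mform_def zpoly_conj_sum sum_distrib_left riesz_sum)

lemma mform_const_left: "mform \<tau> (Poly_Mapping.single 0 c * f) g = c * mform \<tau> f g"
  by (simp add: mform_def mult.assoc riesz_const_mult)

lemma mform_const_right: "mform \<tau> f (Poly_Mapping.single 0 c * g) = cnj c * mform \<tau> f g"
  by (simp add: mform_def zpoly_conj_mult mult.left_commute[of f] riesz_const_mult)

lemma mform_mult_left: "mform \<tau> (h * f) g = mform \<tau> f (zpoly_conj h * g)"
  by (simp add: mform_def zpoly_conj_mult mult_ac)

lemma mform_entries:
  assumes "f \<in> polys l" "g \<in> polys l"
  shows "mform \<tau> f g = (\<Sum>a\<in>monomials l. (\<Sum>b\<in>monomials l. loc_entry \<tau> 1 a b * Poly_Mapping.lookup f b) *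
      cnj (Poly_Mapping.lookup g a))"
  using assms by (subst loc_entry_riesz[OF finite_monomials]) (auto simp: polys_def mform_def)

definition mkernel :: "nat \<Rightarrow> ('d::finite mono \<Rightarrow> complex) \<Rightarrow> 'd zpoly set" where
  "mkernel l \<tau> = {f \<in> polys l. \<forall>g\<in>polys l. mform \<tau> f g = 0}"

lemma loc_entry_one: "loc_entry \<tau> 1 a b = \<tau> (b + prod.swap a)"
  by (simp add: loc_entry_def mult_single)

text \<open>Equality of ranks makes every column of the large matrix a combination of columns of
  degree at most \<open>n\<close>. Pushing the coefficients of \<open>f\<close> through these
  relations yields \<open>g\<close> with the same image under the matrix.\<close>

lemma flat_extension_decompose:
  assumes flat: "flat_extension n \<gamma> \<tau>" and f: "f \<in> polys (n + 1)"
  obtains g where "g \<in> polys n" "f - g \<in> mkernel (n + 1) \<tau>"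
proof -
  let ?I = "monomials (n + 1) :: 'a mono set" and ?J = "monomials n :: 'a mono set"
  let ?A = "loc_entry \<tau> 1"
  have J: "?J \<subseteq> ?I" by (auto simp: monomials_def)
  have "rank_on ?I ?A = rank_on ?J (loc_entry \<gamma> 1)"
    using flat by (simp add: flat_extension_def moment_rank_def)
  also have "\<dots> = rank_on ?J ?A"
  proof (rule rank_on_cong)
    fix a b :: "'a mono" assume "a \<in> ?J" "b \<in> ?J"
    then have "b + prod.swap a \<in> monomials (2 * n)"
      by (simp add: monomials_def mdeg_add del: prod.swap_def)
    then show "loc_entry \<gamma> 1 a b = loc_entry \<tau> 1 a b"
      using flat by (simp add: loc_entry_one flat_extension_def)
  qed
  finally have rank: "rank_on ?I ?A = rank_on ?J ?A" .
  have "\<forall>b\<in>?I. \<exists>L. \<forall>a\<in>?I. ?A a b = (\<Sum>c\<in>?J. ?A a c * L c)"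
    using rank_on_subset_eq_columns[OF finite_monomials J rank] by metis
  then obtain L where L: "\<And>a b. b \<in> ?I \<Longrightarrow> a \<in> ?I \<Longrightarrow> ?A a b = (\<Sum>c\<in>?J. ?A a c * L b c)"
    by metis
  define g where "g = zpoly_of ?J (\<lambda>c. \<Sum>b\<in>?I. L b c * Poly_Mapping.lookup f b)"
  have g: "g \<in> polys n" unfolding g_def by (rule zpoly_of_polys)
  have g': "g \<in> polys (n + 1)" using g polys_mono[of n "n + 1"] by auto
  have row: "(\<Sum>b\<in>?I. ?A a b * Poly_Mapping.lookup f b) = (\<Sum>b\<in>?I. ?A a b * Poly_Mapping.lookup g b)"
    if a: "a \<in> ?I" for a
  proof -
    have "(\<Sum>b\<in>?I. ?A a b * Poly_Mapping.lookup f b) =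
        (\<Sum>b\<in>?I. \<Sum>c\<in>?J. ?A a c * L b c * Poly_Mapping.lookup f b)"
      using a by (simp add: L sum_distrib_right)
    also have "\<dots> = (\<Sum>c\<in>?J. ?A a c * (\<Sum>b\<in>?I. L b c * Poly_Mapping.lookup f b))"
      by (subst sum.swap) (simp add: sum_distrib_left mult.assoc)
    also have "\<dots> = (\<Sum>c\<in>?J. ?A a c * Poly_Mapping.lookup g c)"
      by (simp add: g_def lookup_zpoly_of finite_monomials)
    also have "\<dots> = (\<Sum>b\<in>?I. ?A a b * Poly_Mapping.lookup g b)"
      by (rule sum.mono_neutral_left)
        (use J in \<open>auto simp: g_def lookup_zpoly_of finite_monomials\<close>)
    finally show ?thesis .
  qed
  have "mform \<tau> f h = mform \<tau> g h" if "h \<in> polys (n + 1)" for h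
    unfolding mform_entries[OF f that] mform_entries[OF g' that]
    by (rule sum.cong) (simp_all only: row)
  then have "f - g \<in> mkernel (n + 1) \<tau>"
    using f g' by (simp add: mkernel_def polys_diff mform_diff_left)
  then show ?thesis using that g by blast
qed

section \<open>Flat positive semidefinite forms\<close>

lemma mono_Suc_decompose:
  fixes a :: "'d::finite mono"
  assumes "mdeg a = Suc m"
  obtains u b t where "a = u + b" "mdeg b = m" "u = (axis t 1, 0) \<or> u = (0, axis t 1)"
proof -
  have axis: "v = axis t 1 + (v - axis t 1)" if "v $ t \<noteq> 0" for v :: "nat ^ 'd" and t
    using that by (auto simp: vec_eq_iff axis_def)
  have "\<exists>t. fst a $ t \<noteq> 0 \<or> snd a $ t \<noteq> 0"
    using assms by (auto simp: mdeg_def intro: ccontr)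
  then obtain t where "fst a $ t \<noteq> 0 \<or> snd a $ t \<noteq> 0" by blast
  then show thesis
  proof
    assume "fst a $ t \<noteq> 0"
    then have a: "a = (axis t 1, 0) + (fst a - axis t 1, snd a)"
      using axis[of "fst a" t] by (simp add: prod_eq_iff)
    have "mdeg a = 1 + mdeg (fst a - axis t 1, snd a)"
      by (subst a) (simp only: mdeg_add mdeg_axis)
    then show thesis using assms that[OF a] by simp
  next
    assume "snd a $ t \<noteq> 0"
    then have a: "a = (0, axis t 1) + (fst a, snd a - axis t 1)"
      using axis[of "snd a" t] by (simp add: prod_eq_iff)
    have "mdeg a = 1 + mdeg (fst a, snd a - axis t 1)"
      by (subst a) (simp only: mdeg_add mdeg_axis)
    then show thesis using assms that[OF a] by simp
  qed
qed

lemma mdeg_eq_0_iff: "mdeg a = 0 \<longleftrightarrow> a = 0"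
  by (auto simp: mdeg_def prod_eq_iff vec_eq_iff)

lemma mdeg_eq_1_cases:
  fixes u :: "'d::finite mono"
  assumes "mdeg u = 1"
  obtains t where "u = (axis t 1, 0) \<or> u = (0, axis t 1)"
  using mono_Suc_decompose[of u 0] assms mdeg_eq_0_iff by (metis One_nat_def add.right_neutral)

lemma mono_split:
  fixes a :: "'d::finite mono"
  assumes "k \<le> mdeg a"
  shows "\<exists>b c. a = b + c \<and> mdeg b = k"
  using assms
proof (induction k)
  case 0
  show ?case by (rule exI[of _ 0], rule exI[of _ a]) simp
next
  case (Suc k)
  then obtain b c where bc: "a = b + c" "mdeg b = k" by auto
  then have "mdeg c = Suc (mdeg a - Suc k)" using Suc.prems mdeg_add[of b c] by simp
  then obtain u c' t where c: "c = u + c'" "mdeg c' = mdeg a - Suc k"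
    by (rule mono_Suc_decompose)
  have "a = (b + u) + c'" using bc c by (simp add: add.assoc)
  moreover have "mdeg (b + u) = Suc k"
    using bc c Suc.prems mdeg_add[of u c'] \<open>mdeg c = _\<close> by (simp add: mdeg_add)
  ultimately show ?case by blast
qed

text \<open>Every moment of degree at most \<open>2 * m\<close> is thus a value of the form on two
  monomials of degree at most \<open>m\<close>, so a vanishing form has vanishing moments.\<close>

lemma mono_split_half:
  fixes a :: "'d::finite mono"
  assumes "mdeg a \<le> 2 * m"
  obtains b c where "a = b + c" "mdeg b \<le> m" "mdeg c \<le> m"
proof -
  obtain b c where bc: "a = b + c" "mdeg b = min m (mdeg a)"
    using mono_split[of "min m (mdeg a)" a] by auto
  moreover have "mdeg c \<le> m" using bc assms mdeg_add[of b c] by (simp add: min_def split: if_splits)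
  ultimately show ?thesis using that by simp
qed

text \<open>Flatness is expressed modulo the kernel instead of through ranks: in this shape it
  passes at once to any form with a larger kernel, as happens when a point mass is removed.\<close>

locale flat_form =
  fixes n :: nat and \<tau> :: "'d::finite mono \<Rightarrow> complex"
  assumes psd: "f \<in> polys (n + 1) \<Longrightarrow> mform \<tau> f f \<in> \<real>\<^sub>\<ge>\<^sub>0"
    and flat: "f \<in> polys (n + 1) \<Longrightarrow> \<exists>g\<in>polys n. f - g \<in> mkernel (n + 1) \<tau>"
begin

abbreviation "P \<equiv> polys (n + 1) :: 'd zpoly set"
abbreviation "K \<equiv> mkernel (n + 1) \<tau>"

lemma sub: "f \<in> polys n \<Longrightarrow> f \<in> P"
  using polys_mono[of n "n + 1"] by auto

text \<open>Polarization: since the form is real on the diagonal, its value at \<open>f + g\<close>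
  gives opposite imaginary parts and its value at \<open>f\<close> plus the imaginary unit times
  \<open>g\<close> gives equal real parts.\<close>

lemma mform_hermitian:
  assumes f: "f \<in> P" and g: "g \<in> P"
  shows "mform \<tau> g f = cnj (mform \<tau> f g)"
proof -
  have im: "Im (mform \<tau> h h) = 0" if "h \<in> P" for h
    using psd[OF that] by (simp add: complex_nonneg_Reals_iff)
  let ?i = "Poly_Mapping.single 0 \<i> * g"
  have "f + g \<in> P" "f + ?i \<in> P" using f g by (auto intro!: polys_add polys_const_mult)
  then have "Im (mform \<tau> (f + g) (f + g)) = 0" "Im (mform \<tau> (f + ?i) (f + ?i)) = 0"
    using im by blast+
  then show ?thesis
    using im[OF f] im[OF g]
    by (simp add: mform_add_left mform_add_right mform_const_left mform_const_right complex_eq_iff)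
qed

text \<open>The degenerate case of the Cauchy-Schwarz inequality: adding a suitable multiple of the
  null vector \<open>f\<close> to \<open>g\<close> would make the form negative.\<close>

lemma mform_null:
  assumes f: "f \<in> P" and g: "g \<in> P" and 0: "mform \<tau> f f = 0"
  shows "mform \<tau> f g = 0"
proof (rule ccontr)
  define a where "a = mform \<tau> f g"
  assume "mform \<tau> f g \<noteq> 0"
  then have a: "(cmod a)\<^sup>2 > 0" by (simp add: a_def)
  \<comment> \<open>Chosen so that \<open>2 * Re (c * a)\<close> is
    \<open>- (Re (mform \<tau> g g) + 1)\<close>; the form at \<open>?h\<close> then has real part
    -1.\<close>
  define t where "t = (Re (mform \<tau> g g) + 1) / (2 * (cmod a)\<^sup>2)"
  define c where "c = - (of_real t * cnj a)"
  let ?h = "Poly_Mapping.single 0 c * f + g"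
  have "?h \<in> P" using f g by (intro polys_add polys_const_mult)
  then have "Re (mform \<tau> ?h ?h) \<ge> 0" using psd complex_nonneg_Reals_iff by blast
  also have "mform \<tau> ?h ?h = c * a + cnj (c * a) + mform \<tau> g g"
    using mform_hermitian[OF f g] 0
    by (simp add: mform_add_left mform_add_right mform_const_left mform_const_right a_def)
  also have "Re \<dots> = 2 * Re (c * a) + Re (mform \<tau> g g)" by simp
  also have "c * a = - of_real (t * (cmod a)\<^sup>2)"
    by (simp only: c_def of_real_mult complex_norm_square) (simp add: mult_ac)
  also have "2 * Re (- of_real (t * (cmod a)\<^sup>2)) + Re (mform \<tau> g g) = -1"
    using a by (simp add: t_def field_simps)
  finally show False by simp
qed

lemma kernel_mform:
  assumes "k \<in> K" "g \<in> P"
  shows "mform \<tau> k g = 0" "mform \<tau> g k = 0"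
  using assms mform_hermitian[of k g] by (auto simp: mkernel_def)

text \<open>By flatness a test polynomial of degree \<open>n + 1\<close> differs from one of degree
  \<open>n\<close> by a kernel element, and the Hermitian form vanishes against the kernel on either
  side. The degree saved is what later permits moving a factor across the form.\<close>

lemma kernelI_polys:
  assumes h: "h \<in> P" and 0: "\<And>g. g \<in> polys n \<Longrightarrow> mform \<tau> h g = 0"
  shows "h \<in> K"
proof -
  have "mform \<tau> h g = 0" if g: "g \<in> P" for g
  proof -
    obtain g' where g': "g' \<in> polys n" "g - g' \<in> K" using flat g by blast
    have "mform \<tau> h g = mform \<tau> h g' + mform \<tau> h (g - g')"
      by (simp add: mform_diff_right)
    then show ?thesis using 0 g' kernel_mform(2) h by simp
  qed
  then show ?thesis using h by (simp add: mkernel_def)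
qed

text \<open>Moved to the right, the factor becomes \<open>zpoly_conj u * g\<close>, which for
  \<open>g\<close> of degree at most \<open>n\<close> is still an admissible test polynomial for
  \<open>k\<close>.\<close>

lemma kernel_mult:
  assumes k: "k \<in> K" "k \<in> polys n" and u: "u \<in> polys 1"
  shows "u * k \<in> K"
proof (rule kernelI_polys)
  show "u * k \<in> P" using polys_mult[OF u k(2)] by (simp add: add.commute)
  fix g :: "'d zpoly" assume "g \<in> polys n"
  then have "zpoly_conj u * g \<in> P"
    using polys_mult[OF polys_conj[OF u], of g n] by (simp add: add.commute)
  then show "mform \<tau> (u * k) g = 0"
    using k by (simp add: mform_mult_left kernel_mform)
qed

text \<open>\<open>col f\<close> represents the class of \<open>f\<close> modulo the kernel.\<close>

definition col :: "'d zpoly \<Rightarrow> 'd mono \<Rightarrow> complex" where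
  "col f = (\<lambda>a. if a \<in> monomials (n + 1) then mform \<tau> f (Poly_Mapping.single a 1) else 0)"

lemma col_add: "col (f + g) = col f + col g"
  by (auto simp: col_def mform_add_left)

lemma col_diff: "col (f - g) = col f - col g"
  by (auto simp: col_def mform_diff_left)

lemma col_const: "col (Poly_Mapping.single 0 c * f) = cfun_scale c (col f)"
  by (auto simp: col_def mform_const_left cfun_scale_def)

lemma col_sum: "col (\<Sum>x\<in>X. f x) = (\<Sum>x\<in>X. col (f x))"
  by (auto simp: col_def mform_sum_left sum_apply_fun fun_eq_iff)

lemma col_eq_0_iff: "f \<in> P \<Longrightarrow> col f = 0 \<longleftrightarrow> f \<in> K"
proof
  assume f: "f \<in> P" and 0: "col f = 0"
  have "mform \<tau> f g = 0" if g: "g \<in> P" for g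
  proof -
    have entry: "mform \<tau> f (Poly_Mapping.single a 1) = 0" if "a \<in> monomials (n + 1)" for a
      using fun_cong[OF 0, of a] that by (simp add: col_def)
    have "g = (\<Sum>a\<in>monomials (n + 1). Poly_Mapping.single 0 (Poly_Mapping.lookup g a) * Poly_Mapping.single a 1)"
      using g by (intro zpoly_expand) (auto simp: polys_def finite_monomials)
    then have "mform \<tau> f g = (\<Sum>a\<in>monomials (n + 1).
        cnj (Poly_Mapping.lookup g a) * mform \<tau> f (Poly_Mapping.single a 1))"
      by (metis (no_types, lifting) mform_sum_right mform_const_right sum.cong)
    also have "\<dots> = 0" using entry by (intro sum.neutral) simp
    finally show ?thesis .
  qed
  then show "f \<in> K" using f by (simp add: mkernel_def)
next
  assume "f \<in> P" "f \<in> K"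
  then show "col f = 0"
    by (auto simp: col_def fun_eq_iff monomials_def intro!: kernel_mform(1) polys_single)
qed

lemma col_eq_iff: "f \<in> P \<Longrightarrow> g \<in> P \<Longrightarrow> col f = col g \<longleftrightarrow> f - g \<in> K"
  using col_eq_0_iff[of "f - g"] by (simp add: col_diff polys_diff)

lemma col_reduce: "f \<in> P \<Longrightarrow> \<exists>g\<in>polys n. col f = col g"
  using flat[of f] col_eq_iff sub by blast

text \<open>The representative has degree at most \<open>n\<close>, so its product with a monomial
  of degree one stays in \<open>P\<close>.\<close>

definition rep :: "('d mono \<Rightarrow> complex) \<Rightarrow> 'd zpoly" where
  "rep c = (SOME f. f \<in> polys n \<and> col f = c)"

lemma rep:
  assumes "c \<in> col ` polys n"
  shows "rep c \<in> polys n" "col (rep c) = c"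
proof -
  have "\<exists>f. f \<in> polys n \<and> col f = c" using assms by blast
  from someI_ex[OF this] show "rep c \<in> polys n" "col (rep c) = c"
    by (simp_all add: rep_def)
qed

text \<open>On the column space, multiplication by a monomial \<open>u\<close> of degree one.\<close>

definition mult_op :: "'d mono \<Rightarrow> ('d mono \<Rightarrow> complex) \<Rightarrow> 'd mono \<Rightarrow> complex" where
  "mult_op u c = col (Poly_Mapping.single u 1 * rep c)"

lemma mono_mult_polys: "mdeg u = 1 \<Longrightarrow> f \<in> polys n \<Longrightarrow> Poly_Mapping.single u c * f \<in> P"
  using polys_mult[OF polys_single[of u 1 c], of f n] by (simp add: add.commute)

text \<open>Independence of the representative: two of them differ by a kernel element of degree at
  most \<open>n\<close>, to which \<open>kernel_mult\<close> applies.\<close>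

lemma mult_op_col:
  assumes u: "mdeg u = 1" and f: "f \<in> polys n"
  shows "mult_op u (col f) = col (Poly_Mapping.single u 1 * f)"
proof -
  let ?u = "Poly_Mapping.single u (1::complex)" and ?r = "rep (col f)"
  have r: "?r \<in> polys n" "col ?r = col f" using rep f by blast+
  have "?r - f \<in> K" using r f sub col_eq_iff by blast
  then have "?u * (?r - f) \<in> K"
    using r f u by (intro kernel_mult) (auto simp: polys_diff polys_single)
  then have "?u * ?r - ?u * f \<in> K" by (simp add: ring_distribs)
  then show ?thesis
    unfolding mult_op_def using col_eq_iff mono_mult_polys u r f by blast
qed

text \<open>The product of both monomials with \<open>f\<close> may leave \<open>P\<close>, so the
  two compositions are compared through representatives \<open>h\<close> and \<open>h'\<close> in
  \<open>P\<close>. Against \<open>g\<close> of degree at most \<open>n\<close>, both pair to the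
  value of \<open>riesz \<tau>\<close> at the full product, which is symmetric in the two
  monomials.\<close>

lemma mult_op_commute:
  assumes u: "mdeg u = 1" "mdeg u' = 1" and f: "f \<in> polys n"
  shows "mult_op u (mult_op u' (col f)) = mult_op u' (mult_op u (col f))"
proof -
  have *: "\<exists>h\<in>P. mult_op v (mult_op v' (col f)) = col h \<and>
      (\<forall>g\<in>polys n. mform \<tau> h g = riesz \<tau> (Poly_Mapping.single v 1 * Poly_Mapping.single v' 1 * f * zpoly_conj g))"
    if v: "mdeg v = 1" "mdeg v' = 1" for v v'
  proof -
    let ?v = "Poly_Mapping.single v (1::complex)" and ?v' = "Poly_Mapping.single v' (1::complex)"
    have P': "?v' * f \<in> P" using mono_mult_polys v f by blast
    then obtain h where h: "h \<in> polys n" "col (?v' * f) = col h" using col_reduce by blast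
    have "mult_op v (mult_op v' (col f)) = col (?v * h)"
      using v f h by (simp add: mult_op_col)
    moreover have "mform \<tau> (?v * h) g = riesz \<tau> (?v * ?v' * f * zpoly_conj g)" if g: "g \<in> polys n" for g
    proof -
      have cg: "zpoly_conj ?v * g \<in> P" using g v mono_mult_polys[of "prod.swap v" g 1] by simp
      \<comment> \<open>Reducing \<open>?v' * f\<close> to \<open>h\<close> does not affect the
        pairing: \<open>?v\<close> moves to the right, where \<open>zpoly_conj ?v * g\<close> has
        degree at most \<open>n + 1\<close>.\<close>
      have "h - ?v' * f \<in> K" using h P' col_eq_iff sub by metis
      then have "mform \<tau> (h - ?v' * f) (zpoly_conj ?v * g) = 0" using cg kernel_mform(1) by blast
      then have "mform \<tau> (?v * h) g = mform \<tau> (?v * (?v' * f)) g"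
        by (simp only: mform_mult_left mform_diff_left right_minus_eq)
      then show ?thesis by (simp add: mform_def mult_ac)
    qed
    ultimately show ?thesis using mono_mult_polys v h by blast
  qed
  obtain h where h: "h \<in> P" "mult_op u (mult_op u' (col f)) = col h"
    "\<And>g. g \<in> polys n \<Longrightarrow> mform \<tau> h g =
      riesz \<tau> (Poly_Mapping.single u 1 * Poly_Mapping.single u' 1 * f * zpoly_conj g)"
    using *[OF u] by blast
  obtain h' where h': "h' \<in> P" "mult_op u' (mult_op u (col f)) = col h'"
    "\<And>g. g \<in> polys n \<Longrightarrow> mform \<tau> h' g =
      riesz \<tau> (Poly_Mapping.single u' 1 * Poly_Mapping.single u 1 * f * zpoly_conj g)"
    using *[OF u(2,1)] by blast
  have "h - h' \<in> K"
    using h h' by (intro kernelI_polys) (auto simp: polys_diff mform_diff_left mult_ac)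
  then show ?thesis using h h' col_eq_iff by simp
qed

text \<open>The operators act on the classes of \<open>polys n\<close>. Multiplication raises the
  degree to \<open>n + 1\<close>, and \<open>col_reduce\<close>, that is flatness, returns the
  product to this space.\<close>

lemma joint_eigenvector:
  assumes "f \<in> polys n" "f \<notin> K"
  obtains e l where "e \<in> polys n" "e \<notin> K"
    "\<And>u. mdeg u = 1 \<Longrightarrow> Poly_Mapping.single u 1 * e - Poly_Mapping.single 0 (l u) * e \<in> K"
proof -
  let ?C = "col ` polys n"
  let ?B = "(\<lambda>a. col (Poly_Mapping.single a 1)) ` monomials n"
  define U :: "'d mono set" where "U = {u. mdeg u = 1}"
  have "U \<subseteq> monomials 1" by (auto simp: monomials_def U_def)
  then have fin: "finite U" using finite_monomials finite_subset by blast
  have sub_C: "cfun.subspace ?C"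
  proof (rule cfun.subspaceI)
    have "col 0 = 0" using col_diff[of 0 0] by simp
    then show "0 \<in> ?C" by (rule image_eqI[OF sym]) simp
    show "x + y \<in> ?C" if "x \<in> ?C" "y \<in> ?C" for x y
      using that by (auto simp: image_iff simp flip: col_add intro!: bexI[of _ "_ + _"] polys_add)
    show "cfun_scale c x \<in> ?C" if "x \<in> ?C" for c x
      using that by (auto simp flip: col_const intro!: imageI polys_const_mult)
  qed
  have span: "?C \<subseteq> cfun.span ?B"
  proof (rule image_subsetI)
    fix g :: "'d zpoly" assume "g \<in> polys n"
    then have "g = (\<Sum>a\<in>monomials n. Poly_Mapping.single 0 (Poly_Mapping.lookup g a) * Poly_Mapping.single a 1)"
      by (intro zpoly_expand) (auto simp: polys_def finite_monomials)
    then have "col g = (\<Sum>a\<in>monomials n. cfun_scale (Poly_Mapping.lookup g a) (col (Poly_Mapping.single a 1)))"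
      by (metis (no_types, lifting) col_const col_sum sum.cong)
    then show "col g \<in> cfun.span ?B"
      by (simp only: cfun.span_family_sum)
  qed
  have maps: "mult_op u x \<in> ?C" if ux: "u \<in> U" "x \<in> ?C" for u x
  proof -
    obtain g where g: "g \<in> polys n" "x = col g" using ux by blast
    then have "\<exists>h\<in>polys n. col (Poly_Mapping.single u 1 * g) = col h"
      using ux mono_mult_polys col_reduce by (simp add: U_def)
    then show ?thesis using that g by (auto simp: mult_op_col U_def)
  qed
  have add: "mult_op u (x + y) = mult_op u x + mult_op u y" if ux: "u \<in> U" "x \<in> ?C" "y \<in> ?C" for u x y
  proof -
    obtain g h where gh: "g \<in> polys n" "x = col g" "h \<in> polys n" "y = col h" using ux by blast
    have u: "mdeg u = 1" using that by (simp add: U_def)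
    have "mult_op u (x + y) = mult_op u (col (g + h))" by (simp add: gh col_add)
    also have "\<dots> = col (Poly_Mapping.single u 1 * (g + h))" by (rule mult_op_col[OF u polys_add[OF gh(1,3)]])
    also have "\<dots> = mult_op u x + mult_op u y"
      by (simp add: gh mult_op_col[OF u] ring_distribs col_add)
    finally show ?thesis .
  qed
  have scl: "mult_op u (cfun_scale c x) = cfun_scale c (mult_op u x)" if ux: "u \<in> U" "x \<in> ?C" for u c x
  proof -
    obtain g where g: "g \<in> polys n" "x = col g" using ux by blast
    have u: "mdeg u = 1" using that by (simp add: U_def)
    have "mult_op u (cfun_scale c x) = mult_op u (col (Poly_Mapping.single 0 c * g))"
      by (simp add: g col_const)
    also have "\<dots> = col (Poly_Mapping.single u 1 * (Poly_Mapping.single 0 c * g))"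
      by (rule mult_op_col[OF u polys_const_mult[OF g(1)]])
    also have "\<dots> = col (Poly_Mapping.single 0 c * (Poly_Mapping.single u 1 * g))"
      by (simp only: mult.left_commute)
    also have "\<dots> = cfun_scale c (mult_op u x)"
      by (simp only: col_const g mult_op_col[OF u g(1)])
    finally show ?thesis .
  qed
  have comm: "mult_op u (mult_op u' x) = mult_op u' (mult_op u x)"
    if "u \<in> U" "u' \<in> U" "x \<in> ?C" for u u' x
    using that mult_op_commute[of u u'] unfolding U_def by blast
  have nz: "col f \<noteq> 0" using assms col_eq_0_iff sub by blast
  have fin_B: "finite ?B" by (simp add: finite_monomials)
  have f: "col f \<in> ?C" using assms(1) by (rule imageI)
  obtain w l where w: "w \<in> ?C" "w \<noteq> 0" "\<And>u. u \<in> U \<Longrightarrow> mult_op u w = cfun_scale (l u) w"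
    by (rule cfun.common_eigenvector[where T = mult_op, OF fin sub_C span fin_B f nz maps add scl comm])
      (assumption | rule that)+
  then obtain e where e: "e \<in> polys n" "w = col e" by blast
  show thesis
  proof (rule that[of e l])
    show "e \<notin> K" using e w(2) col_eq_0_iff sub by blast
    fix u :: "'d mono" assume u: "mdeg u = 1"
    have "col (Poly_Mapping.single u 1 * e) = col (Poly_Mapping.single 0 (l u) * e)"
      using w(3)[of u] e u by (simp add: mult_op_col col_const U_def)
    then show "Poly_Mapping.single u 1 * e - Poly_Mapping.single 0 (l u) * e \<in> K"
      using col_eq_iff mono_mult_polys[OF u e(1)] polys_const_mult[OF sub[OF e(1)]] by blast
  qed (use e in simp)
qed

text \<open>Pairing with the eigenvector is a multiple of evaluation at the point formed by its
  eigenvalues, so \<open>e\<close> represents a point evaluation.\<close>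

lemma atom_exists:
  assumes f: "f \<in> polys n" "f \<notin> K"
  obtains w e \<rho> where "e \<in> polys n" "\<rho> > 0" "zpoly_eval e w = 1"
    "\<And>g. g \<in> P \<Longrightarrow> mform \<tau> g e = of_real \<rho> * zpoly_eval g w"
proof -
  obtain e l where e: "e \<in> polys n" "e \<notin> K"
    and l: "\<And>u. mdeg u = 1 \<Longrightarrow> Poly_Mapping.single u 1 * e - Poly_Mapping.single 0 (l u) * e \<in> K"
    using joint_eigenvector[OF f] by blast
  have eP: "e \<in> P" using e(1) by (rule sub)
  have ee: "mform \<tau> e e \<noteq> 0"
  proof
    assume "mform \<tau> e e = 0"
    then have "\<forall>g\<in>P. mform \<tau> e g = 0" using mform_null[OF eP] by blast
    then show False using e eP by (simp add: mkernel_def)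
  qed
  have right: "mform \<tau> g (Poly_Mapping.single u 1 * e) = cnj (l u) * mform \<tau> g e"
    if "g \<in> P" "mdeg u = 1" for g u
    using kernel_mform(2)[OF l[OF that(2)] that(1)] by (simp add: mform_diff_right mform_const_right)
  have left: "mform \<tau> (Poly_Mapping.single u 1 * e) g = l u * mform \<tau> e g"
    if "g \<in> P" "mdeg u = 1" for g u
    using kernel_mform(1)[OF l[OF that(2)] that(1)] by (simp add: mform_diff_left mform_const_left)
  \<comment> \<open>The form of \<open>u * e\<close> against \<open>e\<close> is computed on either
    side by adjointness; the factor \<open>mform \<tau> e e\<close> is nonzero since a null vector
    would belong to the kernel.\<close>
  have l_swap: "l (prod.swap u) = cnj (l u)" if u: "mdeg u = 1" for u
  proof -
    have "l u * mform \<tau> e e = mform \<tau> e (Poly_Mapping.single (prod.swap u) 1 * e)"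
      using left[OF eP u] by (simp only: mform_mult_left zpoly_conj_single complex_cnj_one)
    also have "\<dots> = cnj (l (prod.swap u)) * mform \<tau> e e"
      using right[OF eP] u by simp
    finally show ?thesis using ee by simp
  qed
  define w :: "complex ^ 'd" where "w = (\<chi> t. l (0, axis t 1))"
  have l_eval: "l u = mono_eval u w" if u: "mdeg u = 1" for u
  proof -
    obtain t where t: "u = (axis t 1, 0) \<or> u = (0, axis t 1)" using u by (rule mdeg_eq_1_cases)
    have ax: "l (0, axis t 1) = mono_eval (0, axis t 1) w" for t
      by (subst mono_eval_axis) (simp add: w_def)
    from t show ?thesis
    proof
      assume u': "u = (axis t 1, 0)"
      then have "l (prod.swap u) = mono_eval (prod.swap u) w" using ax by simp
      then show ?thesis using l_swap[OF u] by (simp add: mono_eval_swap del: prod.swap_def)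
    qed (simp only: ax)
  qed
  \<comment> \<open>A factor of degree one moves to the right and acts on \<open>e\<close> there as
    a scalar; this strips the monomial down to 1.\<close>
  have mono: "mform \<tau> (Poly_Mapping.single a 1) e = mono_eval a w * mform \<tau> 1 e"
    if "mdeg a \<le> n + 1" for a
    using that
  proof (induction "mdeg a" arbitrary: a)
    case 0
    then have "a = 0" using mdeg_eq_0_iff[of a] by simp
    then show ?case by (simp add: single_one)
  next
    case (Suc m)
    obtain u b t where a: "a = u + b" "mdeg b = m" "u = (axis t 1, 0) \<or> u = (0, axis t 1)"
      using mono_Suc_decompose[of a m] Suc.hyps(2) by metis
    have u: "mdeg u = 1" using a Suc.hyps(2) mdeg_add[of u b] by simp
    have bP: "Poly_Mapping.single b 1 \<in> P" using a Suc by (intro polys_single) simp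
    have "mform \<tau> (Poly_Mapping.single a 1) e = mform \<tau> (Poly_Mapping.single u 1 * Poly_Mapping.single b 1) e"
      by (simp add: a(1) mult_single)
    also have "\<dots> = mform \<tau> (Poly_Mapping.single b 1) (Poly_Mapping.single (prod.swap u) 1 * e)"
      by (simp only: mform_mult_left zpoly_conj_single complex_cnj_one)
    also have "\<dots> = cnj (l (prod.swap u)) * mform \<tau> (Poly_Mapping.single b 1) e"
      using right[OF bP] u by simp
    also have "\<dots> = mono_eval u w * mform \<tau> (Poly_Mapping.single b 1) e"
      by (simp only: l_swap[OF u] l_eval[OF u] complex_cnj_cnj)
    also have "mform \<tau> (Poly_Mapping.single b 1) e = mono_eval b w * mform \<tau> 1 e"
      using Suc a(2) by (intro Suc.hyps(1)) auto
    finally show ?case by (simp add: a(1) mono_eval_add)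
  qed
  have eval: "mform \<tau> g e = zpoly_eval g w * mform \<tau> 1 e" if g: "g \<in> P" for g
  proof -
    have "g = (\<Sum>a\<in>monomials (n + 1). Poly_Mapping.single 0 (Poly_Mapping.lookup g a) * Poly_Mapping.single a 1)"
      using g by (intro zpoly_expand) (auto simp: polys_def finite_monomials)
    then have "mform \<tau> g e = (\<Sum>a\<in>monomials (n + 1).
        Poly_Mapping.lookup g a * mform \<tau> (Poly_Mapping.single a 1) e)"
      by (metis (no_types, lifting) mform_sum_left mform_const_left sum.cong)
    also have "\<dots> = (\<Sum>a\<in>monomials (n + 1). mono_eval a w * Poly_Mapping.lookup g a * mform \<tau> 1 e)"
      by (rule sum.cong) (auto simp: mono monomials_def)
    finally show ?thesis by (simp add: zpoly_eval_polys[OF g] sum_distrib_right)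
  qed
  have nz: "zpoly_eval e w \<noteq> 0" using eval[OF eP] ee by auto
  define e' where "e' = Poly_Mapping.single 0 (1 / zpoly_eval e w) * e"
  \<comment> \<open>The form is conjugate linear on the right, hence the \<open>cnj\<close>. As
    \<open>e'\<close> has value 1 at \<open>w\<close>, the constant \<open>c\<close> equals
    \<open>mform \<tau> e' e'\<close>, which is where the positivity of the weight comes
    from.\<close>
  define c where "c = cnj (1 / zpoly_eval e w) * mform \<tau> 1 e"
  have e': "e' \<in> polys n" unfolding e'_def using e(1) by (rule polys_const_mult)
  have e'1: "zpoly_eval e' w = 1" using nz by (simp add: e'_def zpoly_eval_mult)
  have eval': "mform \<tau> g e' = c * zpoly_eval g w" if "g \<in> P" for g
    by (simp add: e'_def c_def mform_const_right eval[OF that])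
  have "mform \<tau> e' e' = c" using eval'[OF sub[OF e']] e'1 by simp
  then have "c \<in> \<real>\<^sub>\<ge>\<^sub>0" using psd[OF sub[OF e']] by simp
  moreover have "c \<noteq> 0" using nz eval[OF eP] ee by (auto simp: c_def)
  ultimately have "Re c > 0" "c = of_real (Re c)"
    by (auto simp: complex_nonneg_Reals_iff complex_eq_iff order_less_le)
  then show thesis using that[of e' "Re c" w] e' e'1 eval' by metis
qed

section \<open>Removal of one atom from a flat form\<close>

context
  fixes w :: "complex ^ 'd" and e :: "'d zpoly" and \<rho> :: real
  assumes e: "e \<in> polys n" "zpoly_eval e w = 1"
    and rho: "\<rho> > 0"
    and repr: "\<And>g. g \<in> P \<Longrightarrow> mform \<tau> g e = of_real \<rho> * zpoly_eval g w"
begin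

private definition "\<sigma> = (\<lambda>a. \<tau> a - of_real \<rho> * mono_eval a w)"

private lemma mform_peel: "mform \<sigma> f g = mform \<tau> f g - of_real \<rho> * (zpoly_eval f w * cnj (zpoly_eval g w))"
proof -
  have "riesz \<sigma> q = riesz \<tau> q - of_real \<rho> * zpoly_eval q w" for q
    by (simp add: riesz_def \<sigma>_def zpoly_eval_def ring_distribs sum_subtractf sum_distrib_left mult_ac)
  then show ?thesis by (simp add: mform_def zpoly_eval_mult zpoly_eval_conj)
qed

text \<open>A kernel element is orthogonal to \<open>e\<close>, hence vanishes at \<open>w\<close>,
  and the subtracted point mass does not see it.\<close>

lemma peel_kernel: "f \<in> K \<Longrightarrow> f \<in> mkernel (n + 1) (\<lambda>a. \<tau> a - of_real \<rho> * mono_eval a w)"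
proof -
  assume f: "f \<in> K"
  then have fP: "f \<in> P" by (simp add: mkernel_def)
  have "mform \<tau> f e = 0" using f e sub by (simp add: mkernel_def)
  then have "zpoly_eval f w = 0" using repr[OF fP] rho by simp
  then show ?thesis using f by (simp add: mkernel_def mform_peel flip: \<sigma>_def)
qed

text \<open>On \<open>e\<close>, whose value at \<open>w\<close> is 1, the old form and the
  subtracted one agree. Before the subtraction \<open>e\<close> was outside the kernel, as
  \<open>mform \<tau> e e\<close> is \<open>\<rho>\<close>, so the kernel grows strictly.\<close>

lemma peel_kernel_atom: "e \<in> mkernel (n + 1) (\<lambda>a. \<tau> a - of_real \<rho> * mono_eval a w)"
proof -
  have "mform \<tau> e g = of_real \<rho> * cnj (zpoly_eval g w)" if "g \<in> P" for g
    using mform_hermitian[OF that sub[OF e(1)]] repr[OF that] by simp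
  then show ?thesis using e sub by (simp add: mkernel_def mform_peel flip: \<sigma>_def)
qed

lemma peel_flat_form: "flat_form n (\<lambda>a. \<tau> a - of_real \<rho> * mono_eval a w)"
proof
  fix f :: "'d zpoly" assume f: "f \<in> polys (n + 1)"
  \<comment> \<open>The component of \<open>f\<close> orthogonal to \<open>e\<close>, because the
    quotient of \<open>mform \<tau> f e\<close> by \<open>mform \<tau> e e\<close> is the value of
    \<open>f\<close> at \<open>w\<close>. Its form value is that of \<open>f\<close> under the
    peeled form.\<close>
  define h where "h = f - Poly_Mapping.single 0 (zpoly_eval f w) * e"
  have eP: "e \<in> P" using e(1) by (rule sub)
  have h: "h \<in> P" unfolding h_def using f eP by (intro polys_diff polys_const_mult)
  have fe: "mform \<tau> f e = of_real \<rho> * zpoly_eval f w" and ee: "mform \<tau> e e = of_real \<rho>"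
    using repr[OF f] repr[OF eP] e by simp_all
  have ef: "mform \<tau> e f = of_real \<rho> * cnj (zpoly_eval f w)"
    using mform_hermitian[OF f eP] fe by simp
  have "mform \<tau> h h = mform \<sigma> f f"
    unfolding h_def mform_peel mform_diff_left mform_diff_right mform_const_left mform_const_right fe ee ef
    by (simp add: algebra_simps)
  then show "mform (\<lambda>a. \<tau> a - of_real \<rho> * mono_eval a w) f f \<in> \<real>\<^sub>\<ge>\<^sub>0"
    using psd[OF h] by (simp add: \<sigma>_def)
  show "\<exists>g\<in>polys n. f - g \<in> mkernel (n + 1) (\<lambda>a. \<tau> a - of_real \<rho> * mono_eval a w)"
    using flat[OF f] peel_kernel by blast
qed

end

end

text \<open>Lagrange interpolation polynomials for the points. Their existence means that the
  evaluations at the points are linearly independent functionals on \<open>polys n\<close>.\<close>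

definition dual_atoms :: "nat \<Rightarrow> 's set \<Rightarrow> ('s \<Rightarrow> complex ^ 'd) \<Rightarrow> ('s \<Rightarrow> 'd::finite zpoly) \<Rightarrow> bool" where
  "dual_atoms n S \<omega> e \<longleftrightarrow> finite S \<and> (\<forall>s\<in>S. e s \<in> polys n) \<and>
     (\<forall>s\<in>S. \<forall>t\<in>S. zpoly_eval (e s) (\<omega> t) = (if s = t then 1 else 0))"

definition atomic_moments :: "'s set \<Rightarrow> ('s \<Rightarrow> real) \<Rightarrow> ('s \<Rightarrow> complex ^ 'd) \<Rightarrow> 'd::finite mono \<Rightarrow> complex" where
  "atomic_moments S \<rho> \<omega> = (\<lambda>a. \<Sum>s\<in>S. of_real (\<rho> s) * mono_eval a (\<omega> s))"

lemma riesz_atomic_moments: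
  "riesz (atomic_moments S \<rho> \<omega>) q = (\<Sum>s\<in>S. of_real (\<rho> s) * zpoly_eval q (\<omega> s))"
  by (simp add: riesz_def atomic_moments_def zpoly_eval_def sum_distrib_left mult_ac sum.swap[of _ S])

lemma loc_entry_atomic_moments:
  "loc_entry (atomic_moments S \<rho> \<omega>) p a b =
     (\<Sum>s\<in>S. of_real (\<rho> s) * zpoly_eval p (\<omega> s) * cnj (mono_eval a (\<omega> s)) * mono_eval b (\<omega> s))"
  by (simp add: loc_entry_def riesz_atomic_moments zpoly_eval_mult mono_eval_swap mult_ac)

text \<open>Each atom contributes one rank-one term, weighted by \<open>\<rho> s\<close> times the
  value of \<open>p\<close>; terms of weight zero drop out. Coefficients of the interpolation
  polynomials are dual to the remaining evaluation vectors, on the left after conjugation and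
  division by the weight.\<close>

lemma rank_on_atomic_moments:
  assumes "dual_atoms n S \<omega> e" "\<And>s. s \<in> S \<Longrightarrow> \<rho> s \<noteq> 0"
  shows "rank_on (monomials n) (loc_entry (atomic_moments S \<rho> \<omega>) p) =
    card {s\<in>S. zpoly_eval p (\<omega> s) \<noteq> 0}"
proof -
  let ?S = "{s\<in>S. zpoly_eval p (\<omega> s) \<noteq> 0}"
  let ?c = "\<lambda>s. of_real (\<rho> s) * zpoly_eval p (\<omega> s)"
  have fin: "finite S" using assms by (simp add: dual_atoms_def)
  have dual: "(\<Sum>b\<in>monomials n. mono_eval b (\<omega> s) * Poly_Mapping.lookup (e t) b) = (if s = t then 1 else 0)"
    if "s \<in> S" "t \<in> S" for s t
    using assms(1) that by (auto simp: dual_atoms_def simp flip: zpoly_eval_polys)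
  show ?thesis
  proof (rule rank_on_sum_eq[where x = "\<lambda>s a. ?c s * cnj (mono_eval a (\<omega> s))"
        and y = "\<lambda>s b. mono_eval b (\<omega> s)" and L = "\<lambda>t b. Poly_Mapping.lookup (e t) b"
        and L' = "\<lambda>t a. cnj (Poly_Mapping.lookup (e t) a) / ?c t"])
    fix a b :: "'b mono"
    show "loc_entry (atomic_moments S \<rho> \<omega>) p a b =
        (\<Sum>s\<in>?S. ?c s * cnj (mono_eval a (\<omega> s)) * mono_eval b (\<omega> s))"
      unfolding loc_entry_atomic_moments by (rule sum.mono_neutral_right) (use fin in auto)
  next
    fix s t assume st: "s \<in> ?S" "t \<in> ?S"
    have "(\<Sum>a\<in>monomials n. ?c s * cnj (mono_eval a (\<omega> s)) * (cnj (Poly_Mapping.lookup (e t) a) / ?c t)) =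
        ?c s / ?c t * cnj (\<Sum>b\<in>monomials n. mono_eval b (\<omega> s) * Poly_Mapping.lookup (e t) b)"
      by (simp add: sum_distrib_left sum_divide_distrib mult_ac)
    also have "\<dots> = (if s = t then 1 else 0)"
      using st assms(2) by (subst dual) auto
    finally show "(\<Sum>a\<in>monomials n. ?c s * cnj (mono_eval a (\<omega> s)) * (cnj (Poly_Mapping.lookup (e t) a) / ?c t)) =
        (if s = t then 1 else 0)" .
  qed (use fin dual finite_monomials in auto)
qed

text \<open>With unit weights the number of points is the rank of a matrix with one column per
  monomial. This bound makes the removal of atoms terminate.\<close>

lemma dual_atoms_card_le:
  fixes \<omega> :: "'s \<Rightarrow> complex ^ 'd::finite"
  assumes "dual_atoms n S \<omega> e"
  shows "card S \<le> card (monomials n :: 'd mono set)"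
proof -
  have "card S = rank_on (monomials n) (loc_entry (atomic_moments S (\<lambda>_. 1) \<omega>) 1)"
    using rank_on_atomic_moments[OF assms, of "\<lambda>_. 1" 1] by simp
  also have "\<dots> \<le> card (column_on (monomials n) (loc_entry (atomic_moments S (\<lambda>_. 1) \<omega>) 1) ` monomials n)"
    unfolding rank_on_column using finite_monomials by (intro cfun.dim_le_card') auto
  also have "\<dots> \<le> card (monomials n :: 'd mono set)"
    using finite_monomials by (rule card_image_le)
  finally show ?thesis .
qed

lemma dual_atoms_inj: "dual_atoms n S \<omega> e \<Longrightarrow> inj_on \<omega> S"
  by (rule inj_onI) (metis dual_atoms_def zero_neq_one)

text \<open>The invariant after \<open>N\<close> removals. The last clause, that the
  \<open>e s\<close> lie in the kernel of the remaining form, is what allows the interpolation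
  polynomials to be extended to the next atom.\<close>

definition peeled :: "nat \<Rightarrow> ('d::finite mono \<Rightarrow> complex) \<Rightarrow> nat \<Rightarrow> (nat \<Rightarrow> real) \<Rightarrow>
    (nat \<Rightarrow> complex ^ 'd) \<Rightarrow> (nat \<Rightarrow> 'd zpoly) \<Rightarrow> bool" where
  "peeled n \<tau> N \<rho> \<omega> e \<longleftrightarrow> dual_atoms n {1..N} \<omega> e \<and> (\<forall>s\<in>{1..N}. \<rho> s > 0) \<and>
     flat_form n (\<lambda>a. \<tau> a - atomic_moments {1..N} \<rho> \<omega> a) \<and>
     (\<forall>s\<in>{1..N}. e s \<in> mkernel (n + 1) (\<lambda>a. \<tau> a - atomic_moments {1..N} \<rho> \<omega> a))"

text \<open>The old \<open>e s\<close> pair to zero with the new \<open>d\<close>, and so vanish at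
  \<open>w\<close>. Correcting \<open>d\<close> by a combination of them changes neither its value
  at \<open>w\<close> nor the pairing with it.\<close>

lemma peeled_step:
  assumes peeled: "peeled n \<tau> N \<rho> \<omega> e"
    and nz: "f \<in> polys n" "f \<notin> mkernel (n + 1) (\<lambda>a. \<tau> a - atomic_moments {1..N} \<rho> \<omega> a)"
  shows "\<exists>\<rho> \<omega> e. peeled n \<tau> (Suc N) \<rho> \<omega> e"
proof -
  let ?\<sigma> = "\<lambda>a. \<tau> a - atomic_moments {1..N} \<rho> \<omega> a"
  have "flat_form n ?\<sigma>" using peeled by (simp only: peeled_def)
  then interpret flat_form n ?\<sigma> .
  have dual: "dual_atoms n {1..N} \<omega> e" and ek: "\<And>s. s \<in> {1..N} \<Longrightarrow> e s \<in> K"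
    and pos: "\<And>s. s \<in> {1..N} \<Longrightarrow> \<rho> s > 0"
    using peeled by (auto simp: peeled_def)
  obtain w d r where d: "d \<in> polys n" "r > 0" "zpoly_eval d w = 1"
    and dr: "\<And>g. g \<in> P \<Longrightarrow> mform ?\<sigma> g d = of_real r * zpoly_eval g w"
    by (rule atom_exists[OF nz]) (assumption | rule that)+
  have en: "e s \<in> polys n" if "s \<in> {1..N}" for s using dual that by (simp add: dual_atoms_def)
  have ew: "zpoly_eval (e s) w = 0" if s: "s \<in> {1..N}" for s
  proof -
    have "mform ?\<sigma> (e s) d = 0" by (rule kernel_mform(1)[OF ek[OF s] sub[OF d(1)]])
    then show ?thesis using dr[OF sub[OF en[OF s]]] d by simp
  qed
  \<comment> \<open>Adding kernel elements makes the new polynomial vanish at the old atoms.\<close>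
  define k where "k = (\<Sum>s=1..N. Poly_Mapping.single 0 (zpoly_eval d (\<omega> s)) * e s)"
  define d' where "d' = d - k"
  have kn: "k \<in> polys n" unfolding k_def using en by (intro polys_sum polys_const_mult) auto
  have kK: "mform ?\<sigma> g k = 0" if "g \<in> P" for g
    using kernel_mform(2)[OF ek that] by (simp add: k_def mform_sum_right mform_const_right)
  have d'n: "d' \<in> polys n" unfolding d'_def using d kn by (intro polys_diff)
  have "zpoly_eval k w = 0" using ew by (simp add: k_def zpoly_eval_sum zpoly_eval_mult)
  then have d'w: "zpoly_eval d' w = 1" by (simp add: d'_def zpoly_eval_diff d)
  have d'0: "zpoly_eval d' (\<omega> t) = 0" if t: "t \<in> {1..N}" for t
  proof -
    have "zpoly_eval k (\<omega> t) = (\<Sum>s=1..N. if s = t then zpoly_eval d (\<omega> s) else 0)"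
      unfolding k_def zpoly_eval_sum zpoly_eval_mult
      by (rule sum.cong) (use dual t in \<open>auto simp: dual_atoms_def\<close>)
    also have "\<dots> = zpoly_eval d (\<omega> t)" using t by simp
    finally show ?thesis by (simp add: d'_def zpoly_eval_diff)
  qed
  have d'r: "mform ?\<sigma> g d' = of_real r * zpoly_eval g w" if "g \<in> P" for g
    using dr[OF that] kK[OF that] by (simp add: d'_def mform_diff_right)
  define \<rho>' where "\<rho>' = (\<lambda>s. if s = Suc N then r else \<rho> s)"
  define \<omega>' where "\<omega>' = (\<lambda>s. if s = Suc N then w else \<omega> s)"
  define e' where "e' = (\<lambda>s. if s = Suc N then d' else e s)"
  have "atomic_moments {1..N} \<rho>' \<omega>' = atomic_moments {1..N} \<rho> \<omega>"
    unfolding atomic_moments_def by (intro ext sum.cong) (auto simp: \<rho>'_def \<omega>'_def)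
  then have "atomic_moments {1..Suc N} \<rho>' \<omega>' a = atomic_moments {1..N} \<rho> \<omega> a + of_real r * mono_eval a w" for a
    by (simp add: atomic_moments_def fun_eq_iff) (simp add: \<rho>'_def \<omega>'_def)
  then have eq: "(\<lambda>a. \<tau> a - atomic_moments {1..Suc N} \<rho>' \<omega>' a) = (\<lambda>a. ?\<sigma> a - of_real r * mono_eval a w)"
    by (simp add: fun_eq_iff)
  have "dual_atoms n {1..Suc N} \<omega>' e'"
    using dual ew d'w d'0 d'n by (auto simp: dual_atoms_def \<omega>'_def e'_def le_Suc_eq)
  moreover have "\<forall>s\<in>{1..Suc N}. \<rho>' s > 0" using pos d(2) by (auto simp: \<rho>'_def le_Suc_eq)
  moreover have "\<forall>s\<in>{1..Suc N}. e' s \<in> mkernel (n + 1) (\<lambda>a. ?\<sigma> a - of_real r * mono_eval a w)"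
  proof
    fix s assume s: "s \<in> {1..Suc N}"
    show "e' s \<in> mkernel (n + 1) (\<lambda>a. ?\<sigma> a - of_real r * mono_eval a w)"
    proof (cases "s = Suc N")
      case True
      then show ?thesis using peel_kernel_atom[OF d'n d'w d(2) d'r] by (simp add: e'_def)
    next
      case False
      then have "s \<in> {1..N}" using s by auto
      then show ?thesis using peel_kernel[OF d'n d'w d(2) d'r ek] False by (simp add: e'_def)
    qed
  qed
  moreover note peel_flat_form[OF d'n d'w d(2) d'r]
  ultimately have "peeled n \<tau> (Suc N) \<rho>' \<omega>' e'"
    by (simp only: peeled_def eq ball_simps HOL.simp_thms)
  then show ?thesis by blast
qed

text \<open>The number of removable atoms is bounded, so a greatest one exists. At that stage
  \<open>peeled_step\<close> forces all of \<open>polys n\<close> into the kernel, flatness extends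
  this to degree \<open>n + 1\<close>, and splitting monomials turns it into a statement on
  moments.\<close>

lemma (in flat_form) atomic_representation:
  obtains N :: nat and \<rho> \<omega> e where "dual_atoms n {1..N} \<omega> e" "\<And>s. s \<in> {1..N} \<Longrightarrow> \<rho> s > 0"
    "\<And>a. a \<in> monomials (2 * (n + 1)) \<Longrightarrow> \<tau> a = atomic_moments {1..N} \<rho> \<omega> a"
proof -
  let ?Q = "\<lambda>N. \<exists>\<rho> \<omega> e. peeled n \<tau> N \<rho> \<omega> e"
  have "(\<lambda>a. \<tau> a - atomic_moments {1..0} \<rho> \<omega> a) = \<tau>" for \<rho> and \<omega> :: "nat \<Rightarrow> complex ^ 'd"
    by (simp add: atomic_moments_def)
  then have Q0: "?Q 0" using flat_form_axioms by (simp add: peeled_def dual_atoms_def)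
  have bound: "M \<le> card (monomials n :: 'd mono set)" if "?Q M" for M
  proof -
    from that obtain \<rho> \<omega> e where "peeled n \<tau> M \<rho> \<omega> e" by blast
    then have "dual_atoms n {1..M} \<omega> e" by (simp only: peeled_def)
    from dual_atoms_card_le[OF this] show ?thesis by simp
  qed
  define N where "N = (GREATEST N. ?Q N)"
  have "?Q N" unfolding N_def by (rule GreatestI_nat[of ?Q, OF Q0 bound])
  then obtain \<rho> \<omega> e where p: "peeled n \<tau> N \<rho> \<omega> e" by blast
  have max: "M \<le> N" if "?Q M" for M
    unfolding N_def by (rule Greatest_le_nat[of ?Q, OF that bound])
  let ?\<sigma> = "\<lambda>a. \<tau> a - atomic_moments {1..N} \<rho> \<omega> a"
  have "flat_form n ?\<sigma>" using p by (simp only: peeled_def)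
  then interpret s: flat_form n ?\<sigma> .
  have ker: "f \<in> s.K" if "f \<in> polys n" for f
  proof (rule ccontr)
    assume "f \<notin> s.K"
    from max[OF peeled_step[OF p that this]] show False by simp
  qed
  have zero: "mform ?\<sigma> f g = 0" if f: "f \<in> polys (n + 1)" and g: "g \<in> polys (n + 1)" for f g
  proof -
    obtain h where h: "h \<in> polys n" "f - h \<in> s.K" using s.flat[OF f] by blast
    show ?thesis
      using s.kernel_mform(1)[OF h(2) g] s.kernel_mform(1)[OF ker[OF h(1)] g]
      by (simp add: mform_diff_left)
  qed
  show thesis
  proof (rule that[of N \<omega> e \<rho>])
    fix a :: "'d mono" assume "a \<in> monomials (2 * (n + 1))"
    then have "mdeg a \<le> 2 * (n + 1)" by (simp add: monomials_def)
    then obtain b c where bc: "a = b + c" "mdeg b \<le> n + 1" "mdeg c \<le> n + 1"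
      by (rule mono_split_half)
    have "mform ?\<sigma> (Poly_Mapping.single b 1) (Poly_Mapping.single (prod.swap c) 1) = ?\<sigma> a"
      by (simp add: mform_def mult_single bc(1) del: prod.swap_def)
    then show "\<tau> a = atomic_moments {1..N} \<rho> \<omega> a"
      using zero[OF polys_single[OF bc(2)] polys_single[of "prod.swap c" "n + 1"]] bc(3) by simp
  qed (use p in \<open>auto simp: peeled_def\<close>)
qed

section \<open>Finitely atomic measures\<close>

text \<open>A push-forward from the index set reduces integrals to finite sums; weights at
  coinciding points add up.\<close>

definition atomic_measure :: "'s set \<Rightarrow> ('s \<Rightarrow> real) \<Rightarrow> ('s \<Rightarrow> 'a) \<Rightarrow> 'a::topological_space measure" where
  "atomic_measure S \<rho> \<omega> = distr (point_measure S (\<lambda>s. ennreal (\<rho> s))) borel \<omega>"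

lemma sets_atomic_measure [simp, measurable_cong]: "sets (atomic_measure S \<rho> \<omega>) = sets borel"
  by (simp add: atomic_measure_def)

lemma measurable_point_measure_borel: "\<omega> \<in> measurable (point_measure S f) borel"
  by (simp add: measurable_point_measure_eq1)

lemma emeasure_atomic_measure:
  assumes "finite S" "A \<in> sets borel"
  shows "emeasure (atomic_measure S \<rho> \<omega>) A = (\<Sum>s\<in>S. ennreal (\<rho> s) * indicator A (\<omega> s))"
proof -
  have "emeasure (atomic_measure S \<rho> \<omega>) A = (\<Sum>s\<in>\<omega> -` A \<inter> S. ennreal (\<rho> s))"
    unfolding atomic_measure_def using assms measurable_point_measure_borel
    by (simp add: emeasure_distr emeasure_point_measure_finite space_point_measure)
  also have "\<dots> = (\<Sum>s\<in>S. ennreal (\<rho> s) * indicator A (\<omega> s))"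
    using assms(1) by (intro sum.mono_neutral_cong_left) (auto simp: indicator_def)
  finally show ?thesis .
qed

lemma has_bochner_integral_atomic_measure:
  fixes f :: "'a::topological_space \<Rightarrow> 'b::{banach, second_countable_topology}"
  assumes "finite S" "\<And>s. s \<in> S \<Longrightarrow> \<rho> s \<ge> 0" "f \<in> borel_measurable borel"
  shows "has_bochner_integral (atomic_measure S \<rho> \<omega>) f (\<Sum>s\<in>S. \<rho> s *\<^sub>R f (\<omega> s))"
proof -
  have "integrable (atomic_measure S \<rho> \<omega>) f"
    unfolding atomic_measure_def
    by (subst integrable_distr_eq[OF measurable_point_measure_borel assms(3)])
      (rule integrable_point_measure_finite[OF assms(1)])
  moreover have "integral\<^sup>L (atomic_measure S \<rho> \<omega>) f = (\<Sum>s\<in>S. \<rho> s *\<^sub>R f (\<omega> s))"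
    unfolding atomic_measure_def
    by (subst integral_distr[OF measurable_point_measure_borel assms(3)])
      (rule lebesgue_integral_point_measure_finite[OF assms(1,2)])
  ultimately show ?thesis by (simp add: has_bochner_integral_iff)
qed

lemma r_atomic_iff:
  fixes \<nu> :: "'a::topological_space measure"
  shows "r_atomic r \<nu> \<longleftrightarrow> (\<exists>\<omega> \<rho>. inj_on \<omega> {1..r} \<and> (\<forall>s\<in>{1..r}. \<rho> s > 0) \<and> \<nu> = atomic_measure {1..r} \<rho> \<omega>)"
proof
  assume "r_atomic r \<nu>"
  then obtain \<omega> \<rho> where *: "sets \<nu> = sets borel" "inj_on \<omega> {1..r}" "\<forall>s\<in>{1..r}. \<rho> s > 0"
    "\<forall>A\<in>sets borel. emeasure \<nu> A = (\<Sum>s=1..r. ennreal (\<rho> s) * indicator A (\<omega> s))"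
    unfolding r_atomic_def by blast
  have "\<nu> = atomic_measure {1..r} \<rho> \<omega>"
    by (rule measure_eqI) (use * in \<open>auto simp: emeasure_atomic_measure\<close>)
  then show "\<exists>\<omega> \<rho>. inj_on \<omega> {1..r} \<and> (\<forall>s\<in>{1..r}. \<rho> s > 0) \<and> \<nu> = atomic_measure {1..r} \<rho> \<omega>"
    using * by blast
next
  assume "\<exists>\<omega> \<rho>. inj_on \<omega> {1..r} \<and> (\<forall>s\<in>{1..r}. \<rho> s > 0) \<and> \<nu> = atomic_measure {1..r} \<rho> \<omega>"
  then obtain \<omega> \<rho> where *: "inj_on \<omega> {1..r}" "\<forall>s\<in>{1..r}. \<rho> s > 0" "\<nu> = atomic_measure {1..r} \<rho> \<omega>"
    by blast
  have "\<forall>A\<in>sets borel. emeasure \<nu> A = (\<Sum>s=1..r. ennreal (\<rho> s) * indicator A (\<omega> s))"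
    unfolding *(3) by (intro ballI emeasure_atomic_measure) auto
  then show "r_atomic r \<nu>" unfolding r_atomic_def using * by auto
qed

lemma emeasure_atomic_measure_pos:
  assumes "finite S" "s \<in> S" "\<rho> s > 0" "A \<in> sets borel" "\<omega> s \<in> A"
  shows "emeasure (atomic_measure S \<rho> \<omega>) A > 0"
proof -
  have "ennreal (\<rho> s) * indicator A (\<omega> s) \<le> (\<Sum>s\<in>S. ennreal (\<rho> s) * indicator A (\<omega> s))"
    using assms by (intro member_le_sum) auto
  then show ?thesis
    using assms by (simp add: emeasure_atomic_measure ennreal_less_zero_iff order_less_le_trans[of 0 "ennreal (\<rho> s)"])
qed

lemma msupport_atomic_measure:
  fixes \<omega> :: "'s \<Rightarrow> 'a::t1_space"
  assumes fin: "finite S" and pos: "\<And>s. s \<in> S \<Longrightarrow> \<rho> s > 0"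
  shows "msupport (atomic_measure S \<rho> \<omega>) = \<omega> ` S"
proof
  show "\<omega> ` S \<subseteq> msupport (atomic_measure S \<rho> \<omega>)"
    using assms by (auto simp: msupport_def intro!: emeasure_atomic_measure_pos)
  show "msupport (atomic_measure S \<rho> \<omega>) \<subseteq> \<omega> ` S"
  proof
    fix x assume x: "x \<in> msupport (atomic_measure S \<rho> \<omega>)"
    show "x \<in> \<omega> ` S"
    proof (rule ccontr)
      assume "x \<notin> \<omega> ` S"
      moreover have op: "open (- \<omega> ` S)" using fin by (simp add: finite_imp_closed open_Compl)
      ultimately have "emeasure (atomic_measure S \<rho> \<omega>) (- \<omega> ` S) > 0"
        using x by (simp add: msupport_def)
      moreover have "emeasure (atomic_measure S \<rho> \<omega>) (- \<omega> ` S) = 0"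
        using fin op by (subst emeasure_atomic_measure) (auto simp: borel_open)
      ultimately show False by simp
    qed
  qed
qed

lemma atoms_atomic_measure:
  fixes \<omega> :: "'s \<Rightarrow> 'a::t1_space"
  assumes fin: "finite S" and pos: "\<And>s. s \<in> S \<Longrightarrow> \<rho> s > 0"
  shows "atoms (atomic_measure S \<rho> \<omega>) = \<omega> ` S"
proof
  show "\<omega> ` S \<subseteq> atoms (atomic_measure S \<rho> \<omega>)"
    using assms by (auto simp: atoms_def intro!: emeasure_atomic_measure_pos)
  show "atoms (atomic_measure S \<rho> \<omega>) \<subseteq> \<omega> ` S"
  proof
    fix x assume x: "x \<in> atoms (atomic_measure S \<rho> \<omega>)"
    show "x \<in> \<omega> ` S"
    proof (rule ccontr)
      assume "x \<notin> \<omega> ` S"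
      then have "emeasure (atomic_measure S \<rho> \<omega>) {x} = 0"
        using fin by (subst emeasure_atomic_measure) (auto simp: indicator_def)
      then show False using x by (simp add: atoms_def)
    qed
  qed
qed

section \<open>Uniqueness of the representing measure\<close>

lemma continuous_mono_eval: "continuous_on UNIV (mono_eval a)"
  unfolding mono_eval_def [abs_def] by (intro continuous_intros)

lemma borel_measurable_mono_eval [measurable]: "mono_eval a \<in> borel_measurable borel"
  using continuous_mono_eval by (rule borel_measurable_continuous_onI)

lemma borel_measurable_zpoly_eval [measurable]: "zpoly_eval q \<in> borel_measurable borel"
  unfolding zpoly_eval_def [abs_def] by measurable

lemma has_bochner_integral_atomic_moments:
  assumes "finite S" "\<And>s. s \<in> S \<Longrightarrow> \<rho> s \<ge> 0"
  shows "has_bochner_integral (atomic_measure S \<rho> \<omega>) (mono_eval a) (atomic_moments S \<rho> \<omega> a)"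
  using has_bochner_integral_atomic_measure[of S \<rho> "mono_eval a" \<omega>] assms
  by (simp add: atomic_moments_def scaleR_conv_of_real)

lemma representing_atomic_measure_iff:
  assumes "finite S" "\<And>s. s \<in> S \<Longrightarrow> \<rho> s \<ge> 0"
  shows "representing_measure m \<tau> (atomic_measure S \<rho> \<omega>) \<longleftrightarrow>
    (\<forall>a\<in>monomials (2 * m). \<tau> a = atomic_moments S \<rho> \<omega> a)"
proof -
  note H = has_bochner_integral_atomic_moments[where \<rho> = \<rho> and \<omega> = \<omega>, OF assms]
  show ?thesis
    unfolding representing_measure_def
  proof (intro iffI conjI ballI)
    fix a :: "'b mono"
    assume *: "sets (atomic_measure S \<rho> \<omega>) = sets borel \<and>
      (\<forall>a\<in>monomials (2 * m). has_bochner_integral (atomic_measure S \<rho> \<omega>) (mono_eval a) (\<tau> a))"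
      and a: "a \<in> monomials (2 * m)"
    from * a have "has_bochner_integral (atomic_measure S \<rho> \<omega>) (mono_eval a) (\<tau> a)" by blast
    then show "\<tau> a = atomic_moments S \<rho> \<omega> a" using H by (rule has_bochner_integral_eq)
  next
    fix a :: "'b mono"
    assume "\<forall>a\<in>monomials (2 * m). \<tau> a = atomic_moments S \<rho> \<omega> a" "a \<in> monomials (2 * m)"
    then show "has_bochner_integral (atomic_measure S \<rho> \<omega>) (mono_eval a) (\<tau> a)" using H by simp
  qed simp
qed

lemma has_bochner_integral_zpoly_eval:
  assumes "representing_measure m \<tau> \<mu>" "q \<in> polys (2 * m)"
  shows "has_bochner_integral \<mu> (zpoly_eval q) (riesz \<tau> q)"
  unfolding zpoly_eval_def [abs_def] riesz_def
  by (intro has_bochner_integral_sum has_bochner_integral_mult_right)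
    (use assms in \<open>auto simp: representing_measure_def polys_def\<close>)

lemma has_bochner_integral_cmod_zpoly:
  assumes "representing_measure m \<tau> \<mu>" "f \<in> polys m"
  shows "has_bochner_integral \<mu> (\<lambda>z. (cmod (zpoly_eval f z))\<^sup>2) (Re (mform \<tau> f f))"
proof -
  have "f * zpoly_conj f \<in> polys (2 * m)"
    using polys_mult[OF assms(2) polys_conj[OF assms(2)]] by (simp add: mult_2)
  from has_bochner_integral_bounded_linear[OF bounded_linear_Re has_bochner_integral_zpoly_eval[OF assms(1) this]]
  have "has_bochner_integral \<mu> (\<lambda>z. Re (zpoly_eval f z * cnj (zpoly_eval f z))) (Re (mform \<tau> f f))"
    by (simp only: zpoly_eval_mult zpoly_eval_conj mform_def)
  moreover have "Re (c * cnj c) = (cmod c)\<^sup>2" for c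
    by (simp only: Re_complex_of_real flip: complex_norm_square)
  ultimately show ?thesis by (simp only:)
qed

lemma mform_atomic:
  assumes "\<And>a. a \<in> monomials (2 * m) \<Longrightarrow> \<tau> a = atomic_moments S \<rho> \<omega> a" "f \<in> polys m"
  shows "mform \<tau> f f = (\<Sum>s\<in>S. of_real (\<rho> s * (cmod (zpoly_eval f (\<omega> s)))\<^sup>2))"
proof -
  have "f * zpoly_conj f \<in> polys (2 * m)"
    using polys_mult[OF assms(2) polys_conj[OF assms(2)]] by (simp add: mult_2)
  then have "mform \<tau> f f = riesz (atomic_moments S \<rho> \<omega>) (f * zpoly_conj f)"
    unfolding mform_def using assms(1) by (rule riesz_cong_polys)
  then show ?thesis
    by (simp only: riesz_atomic_moments zpoly_eval_mult zpoly_eval_conj of_real_mult complex_norm_square)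
qed

text \<open>The squared modulus of \<open>f\<close> has degree at most \<open>2 * m\<close>, so its
  integral against \<open>\<mu>\<close> is determined by \<open>\<tau>\<close> and equals the
  weighted sum over the atoms, which is zero.\<close>

lemma AE_zpoly_eval_eq_0:
  assumes "representing_measure m \<tau> \<mu>" "f \<in> polys m"
    and "\<And>a. a \<in> monomials (2 * m) \<Longrightarrow> \<tau> a = atomic_moments S \<rho> \<omega> a"
    and "\<And>s. s \<in> S \<Longrightarrow> zpoly_eval f (\<omega> s) = 0"
  shows "AE z in \<mu>. zpoly_eval f z = 0"
proof -
  have "has_bochner_integral \<mu> (\<lambda>z. (cmod (zpoly_eval f z))\<^sup>2) 0"
    using has_bochner_integral_cmod_zpoly[OF assms(1,2)] mform_atomic[OF assms(3,2)] assms(4) by simp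
  then have "integrable \<mu> (\<lambda>z. (cmod (zpoly_eval f z))\<^sup>2)" "(\<integral>z. (cmod (zpoly_eval f z))\<^sup>2 \<partial>\<mu>) = 0"
    by (auto simp: has_bochner_integral_iff)
  then show ?thesis by (simp add: integral_nonneg_eq_0_iff_AE)
qed

text \<open>The polynomials $(z_t - \omega_{s,t}) e_s$ and $1 - \sum_s e_s$ have degree at most $n+1$ and
  vanish at the atoms, hence almost everywhere; their only common zeros are the atoms.\<close>

lemma representing_measure_unique:
  fixes \<omega> :: "'s \<Rightarrow> complex ^ 'd::finite"
  assumes dual: "dual_atoms n S \<omega> e" and pos: "\<And>s. s \<in> S \<Longrightarrow> \<rho> s > 0"
    and \<tau>: "\<And>a. a \<in> monomials (2 * (n + 1)) \<Longrightarrow> \<tau> a = atomic_moments S \<rho> \<omega> a"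
    and \<mu>: "representing_measure (n + 1) \<tau> \<mu>"
  shows "\<mu> = atomic_measure S \<rho> \<omega>"
proof -
  have fin: "finite S" and en: "\<And>s. s \<in> S \<Longrightarrow> e s \<in> polys n"
    and ev: "\<And>s t. s \<in> S \<Longrightarrow> t \<in> S \<Longrightarrow> zpoly_eval (e s) (\<omega> t) = (if s = t then 1 else 0)"
    using dual by (auto simp: dual_atoms_def)
  have en': "e s \<in> polys (n + 1)" if "s \<in> S" for s
    using en[OF that] polys_mono[of n "n + 1"] by auto
  have sets: "sets \<mu> = sets borel" using \<mu> by (simp add: representing_measure_def)
  then have space: "space \<mu> = UNIV" using sets_eq_imp_space_eq[OF sets] by simp
  have sum1: "AE z in \<mu>. (\<Sum>s\<in>S. zpoly_eval (e s) z) = 1"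
  proof -
    let ?f = "1 - (\<Sum>s\<in>S. e s)"
    have "AE z in \<mu>. zpoly_eval ?f z = 0"
    proof (rule AE_zpoly_eval_eq_0[OF \<mu> _ \<tau>])
      show "?f \<in> polys (n + 1)" using en' by (intro polys_diff polys_sum) auto
      fix t assume "t \<in> S"
      then show "zpoly_eval ?f (\<omega> t) = 0" using fin by (simp add: zpoly_eval_diff zpoly_eval_sum ev)
    qed
    then show ?thesis
      by (rule eventually_mono) (simp add: zpoly_eval_diff zpoly_eval_sum)
  qed
  have loc: "AE z in \<mu>. (z $ t - \<omega> s $ t) * zpoly_eval (e s) z = 0" if s: "s \<in> S" for s t
  proof -
    define u :: "'d zpoly" where
      "u = Poly_Mapping.single (0, axis t 1) 1 - Poly_Mapping.single 0 (\<omega> s $ t)"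
    have eval: "zpoly_eval u z = z $ t - \<omega> s $ t" for z
      by (simp only: u_def zpoly_eval_diff zpoly_eval_single mono_eval_axis mono_eval_zero mult_1 mult_1_right)
    have "u \<in> polys 1" unfolding u_def by (intro polys_diff polys_single) (simp_all only: mdeg_axis mdeg_zero)
    then have "u * e s \<in> polys (n + 1)" using polys_mult[OF _ en[OF s], of u 1] by (simp add: add.commute)
    then have "AE z in \<mu>. zpoly_eval (u * e s) z = 0"
      using s by (intro AE_zpoly_eval_eq_0[OF \<mu> _ \<tau>]) (auto simp: zpoly_eval_mult eval ev)
    then show ?thesis by (simp add: zpoly_eval_mult eval)
  qed
  have "AE z in \<mu>. \<forall>s\<in>S. \<forall>t\<in>UNIV. (z $ t - \<omega> s $ t) * zpoly_eval (e s) z = 0"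
    by (rule AE_finite_allI[OF fin], rule AE_finite_allI[OF finite], rule loc)
  then have AE: "AE z in \<mu>. z \<in> \<omega> ` S"
    using sum1
  proof eventually_elim
    case (elim z)
    then have "(\<Sum>s\<in>S. zpoly_eval (e s) z) \<noteq> 0" by simp
    \<comment> \<open>The values of the \<open>e s\<close> at \<open>z\<close> sum to 1, so one is
      nonzero; for this \<open>s\<close> the products above force every coordinate of
      \<open>z\<close> to agree with that of \<open>\<omega> s\<close>.\<close>
    then obtain s where s: "s \<in> S" "zpoly_eval (e s) z \<noteq> 0" by (meson sum.neutral)
    then have "z = \<omega> s" using elim by (auto simp: vec_eq_iff)
    then show ?case using s by blast
  qed
  have inj: "inj_on \<omega> S" using dual by (rule dual_atoms_inj)
  have single: "{x} \<in> sets \<mu>" for x using sets by simp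
  have mass: "emeasure \<mu> {\<omega> s} = ennreal (\<rho> s)" if s: "s \<in> S" for s
  proof -
    have "mform \<tau> (e s) (e s) = (\<Sum>t\<in>S. if t = s then of_real (\<rho> s) else 0)"
      by (subst mform_atomic[OF \<tau> en'[OF s]], assumption, rule sum.cong) (use s in \<open>auto simp: ev\<close>)
    then have "has_bochner_integral \<mu> (\<lambda>z. (cmod (zpoly_eval (e s) z))\<^sup>2) (\<rho> s)"
      using has_bochner_integral_cmod_zpoly[OF \<mu> en'[OF s]] s fin by simp
    \<comment> \<open>On the atoms the squared modulus of \<open>e s\<close> is the indicator of
      \<open>\<omega> s\<close>; its integral, fixed by \<open>\<tau>\<close> as
      \<open>\<rho> s\<close>, is therefore the mass at that point.\<close>
    moreover have "AE z in \<mu>. (cmod (zpoly_eval (e s) z))\<^sup>2 = indicator {\<omega> s} z"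
      using AE
    proof eventually_elim
      case (elim z)
      then obtain t where t: "t \<in> S" "z = \<omega> t" by blast
      then show ?case using ev[OF s t(1)] inj s by (auto simp: indicator_def dest: inj_onD)
    qed
    ultimately have "has_bochner_integral \<mu> (indicator {\<omega> s} :: _ \<Rightarrow> real) (\<rho> s)"
      using sets single by (subst (asm) has_bochner_integral_cong_AE) (auto simp: measurable_cong_sets[OF sets refl])
    then have "integrable \<mu> (indicator {\<omega> s} :: _ \<Rightarrow> real)" "measure \<mu> {\<omega> s} = \<rho> s"
      using space by (auto simp: has_bochner_integral_iff)
    then show ?thesis
      using single space by (simp add: integrable_indicator_iff emeasure_eq_ennreal_measure less_top)
  qed
  show ?thesis
  proof (rule measure_eqI)
    show "sets \<mu> = sets (atomic_measure S \<rho> \<omega>)" by (simp add: sets)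
    fix A assume A: "A \<in> sets \<mu>"
    have fin': "finite (A \<inter> \<omega> ` S)" using fin by simp
    have "emeasure \<mu> A = emeasure \<mu> (A \<inter> \<omega> ` S)"
      by (rule emeasure_eq_AE) (use AE A fin' sets in \<open>auto intro: borel_closed finite_imp_closed\<close>)
    also have "\<dots> = (\<Sum>x\<in>A \<inter> \<omega> ` S. emeasure \<mu> {x})"
      using fin' single by (rule emeasure_eq_sum_singleton)
    also have "A \<inter> \<omega> ` S = \<omega> ` {s\<in>S. \<omega> s \<in> A}" by auto
    also have "(\<Sum>x\<in>\<omega> ` {s\<in>S. \<omega> s \<in> A}. emeasure \<mu> {x}) = (\<Sum>s\<in>{s\<in>S. \<omega> s \<in> A}. emeasure \<mu> {\<omega> s})"
      by (subst sum.reindex) (auto intro: inj_on_subset[OF inj])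
    also have "\<dots> = (\<Sum>s\<in>S. ennreal (\<rho> s) * indicator A (\<omega> s))"
      using fin by (intro sum.mono_neutral_cong_left) (auto simp: mass indicator_def)
    also have "\<dots> = emeasure (atomic_measure S \<rho> \<omega>) A"
      using A sets fin by (simp add: emeasure_atomic_measure)
    finally show "emeasure \<mu> A = emeasure (atomic_measure S \<rho> \<omega>) A" .
  qed
qed

section \<open>Flat extensions and localizing matrices of atomic measures\<close>

lemma dual_atoms_mono: "dual_atoms n S \<omega> e \<Longrightarrow> n \<le> l \<Longrightarrow> dual_atoms l S \<omega> e"
  using polys_mono[of n l] by (auto simp: dual_atoms_def)

lemma flat_extension_imp_flat_form:
  assumes "flat_extension n \<gamma> \<tau>"
  shows "flat_form n \<tau>"
proof
  show "mform \<tau> f f \<in> \<real>\<^sub>\<ge>\<^sub>0" if "f \<in> polys (n + 1)" for f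
    using assms that unfolding flat_extension_def moment_psd_mform by blast
  show "\<exists>g\<in>polys n. f - g \<in> mkernel (n + 1) \<tau>" if "f \<in> polys (n + 1)" for f
    using flat_extension_decompose[OF assms that] by blast
qed

lemma psd_on_atomic_moments:
  assumes "\<And>s. s \<in> S \<Longrightarrow> \<rho> s \<ge> 0" "\<And>s. s \<in> S \<Longrightarrow> zpoly_eval p (\<omega> s) \<in> \<real>\<^sub>\<ge>\<^sub>0"
  shows "psd_on (monomials l) (loc_entry (atomic_moments S \<rho> \<omega>) p)"
  unfolding psd_on_loc_entry
proof
  fix f
  have "of_real (\<rho> s) * zpoly_eval (p * f * zpoly_conj f) (\<omega> s) \<in> \<real>\<^sub>\<ge>\<^sub>0" if "s \<in> S" for s
  proof -
    have "of_real (\<rho> s) * zpoly_eval (p * f * zpoly_conj f) (\<omega> s) =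
        of_real (\<rho> s) * zpoly_eval p (\<omega> s) * of_real ((cmod (zpoly_eval f (\<omega> s)))\<^sup>2)"
      unfolding complex_norm_square by (simp add: zpoly_eval_mult zpoly_eval_conj mult_ac)
    also have "\<dots> \<in> \<real>\<^sub>\<ge>\<^sub>0"
      by (intro nonneg_Reals_mult_I assms(2)[OF that]) (simp_all add: assms(1)[OF that])
    finally show ?thesis .
  qed
  then have "(\<Sum>s\<in>S. of_real (\<rho> s) * zpoly_eval (p * f * zpoly_conj f) (\<omega> s)) \<in> \<real>\<^sub>\<ge>\<^sub>0"
    by (induction S rule: infinite_finite_induct) (auto intro: nonneg_Reals_add_I)
  then show "riesz (atomic_moments S \<rho> \<omega>) (p * f * zpoly_conj f) \<in> \<real>\<^sub>\<ge>\<^sub>0"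
    by (simp only: riesz_atomic_moments)
qed

lemma psd_on_atomic_moments_imp:
  assumes dual: "dual_atoms n S \<omega> e" and pos: "\<And>s. s \<in> S \<Longrightarrow> \<rho> s > 0"
    and psd: "psd_on (monomials n) (loc_entry (atomic_moments S \<rho> \<omega>) p)" and s: "s \<in> S"
  shows "zpoly_eval p (\<omega> s) \<in> \<real>\<^sub>\<ge>\<^sub>0"
proof -
  have fin: "finite S" using dual by (simp add: dual_atoms_def)
  have "riesz (atomic_moments S \<rho> \<omega>) (p * e s * zpoly_conj (e s)) =
      (\<Sum>t\<in>S. if t = s then of_real (\<rho> s) * zpoly_eval p (\<omega> s) else 0)"
    unfolding riesz_atomic_moments
    by (rule sum.cong) (use dual s in \<open>auto simp: dual_atoms_def zpoly_eval_mult zpoly_eval_conj\<close>)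
  also have "\<dots> = of_real (\<rho> s) * zpoly_eval p (\<omega> s)" using s fin by simp
  finally have "of_real (\<rho> s) * zpoly_eval p (\<omega> s) \<in> \<real>\<^sub>\<ge>\<^sub>0"
    using psd dual s unfolding psd_on_loc_entry dual_atoms_def by metis
  then show ?thesis
    using pos[OF s] by (auto simp: complex_nonneg_Reals_iff zero_le_mult_iff)
qed

section \<open>Moment ranks and full sequences of atomic measures\<close>

lemma moment_rank_cong:
  assumes "\<And>a. a \<in> monomials (2 * n) \<Longrightarrow> \<sigma> a = \<tau> a"
  shows "moment_rank n \<sigma> = moment_rank n \<tau>"
  unfolding moment_rank_def
proof (rule rank_on_cong)
  fix a b :: "'a mono" assume "a \<in> monomials n" "b \<in> monomials n"
  then have "b + prod.swap a \<in> monomials (2 * n)"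
    by (simp add: monomials_def mdeg_add del: prod.swap_def)
  then show "loc_entry \<sigma> 1 a b = loc_entry \<tau> 1 a b"
    using assms by (simp only: loc_entry_one)
qed

lemma moment_rank_atomic_moments:
  assumes "dual_atoms n S \<omega> e" "\<And>s. s \<in> S \<Longrightarrow> \<rho> s > 0"
  shows "moment_rank n (atomic_moments S \<rho> \<omega>) = card S"
  using rank_on_atomic_moments[OF assms(1), of \<rho> 1] assms(2)
  by (fastforce simp: moment_rank_def)

text \<open>Interpolation in degree \<open>n\<close> already gives the moment matrix of order
  \<open>n\<close> rank \<open>card S\<close>, and the same polynomials give this rank at order
  \<open>n + 1\<close>.\<close>

lemma flat_extension_atomic_moments:
  assumes "dual_atoms n S \<omega> e" "\<And>s. s \<in> S \<Longrightarrow> \<rho> s > 0"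
    and "\<And>a. a \<in> monomials (2 * n) \<Longrightarrow> \<gamma> a = atomic_moments S \<rho> \<omega> a"
  shows "flat_extension n \<gamma> (atomic_moments S \<rho> \<omega>)"
proof -
  have "moment_psd (n + 1) (atomic_moments S \<rho> \<omega>)"
    unfolding moment_psd_def using assms(2) by (intro psd_on_atomic_moments) (auto simp: less_imp_le)
  moreover have "moment_rank (n + 1) (atomic_moments S \<rho> \<omega>) = card S"
    using moment_rank_atomic_moments[OF dual_atoms_mono[OF assms(1)] assms(2)] by simp
  moreover have "moment_rank n \<gamma> = card S"
    using moment_rank_cong[of n \<gamma> "atomic_moments S \<rho> \<omega>"] assms(3)
      moment_rank_atomic_moments[OF assms(1,2)] by simp
  ultimately show ?thesis using assms(3) by (simp add: flat_extension_def)
qed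

text \<open>The atoms may be indexed differently, but moments are integrals against the measure, so
  equality of the measures reaches moments of every degree.\<close>

lemma atomic_measure_moments_eq:
  assumes eq: "atomic_measure S \<rho> \<omega> = atomic_measure S' \<rho>' \<omega>'"
    and S: "finite S" "\<And>s. s \<in> S \<Longrightarrow> \<rho> s > 0" and S': "finite S'" "\<And>s. s \<in> S' \<Longrightarrow> \<rho>' s > 0"
  shows "atomic_moments S \<rho> \<omega> = atomic_moments S' \<rho>' \<omega>'"
proof
  fix a
  have "has_bochner_integral (atomic_measure S \<rho> \<omega>) (mono_eval a) (atomic_moments S \<rho> \<omega> a)"
    using S by (intro has_bochner_integral_atomic_moments) (auto simp: less_imp_le)
  moreover have "has_bochner_integral (atomic_measure S \<rho> \<omega>) (mono_eval a) (atomic_moments S' \<rho>' \<omega>' a)"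
    unfolding eq using S' by (intro has_bochner_integral_atomic_moments) (auto simp: less_imp_le)
  ultimately show "atomic_moments S \<rho> \<omega> a = atomic_moments S' \<rho>' \<omega>' a"
    by (rule has_bochner_integral_eq)
qed

text \<open>Any competitor \<open>\<sigma>\<close> is given, up to a prescribed degree, by atoms of
  its own. Their measure also represents \<open>\<tau>\<close>, so
  \<open>representing_measure_unique\<close> identifies it with the given one.\<close>

lemma full_sequence_atomic_moments:
  fixes \<omega> :: "'s \<Rightarrow> complex ^ 'd::finite"
  assumes dual: "dual_atoms n S \<omega> e" and pos: "\<And>s. s \<in> S \<Longrightarrow> \<rho> s > 0"
    and \<tau>: "\<And>a. a \<in> monomials (2 * (n + 1)) \<Longrightarrow> \<tau> a = atomic_moments S \<rho> \<omega> a"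
  shows "full_sequence (n + 1) \<tau> = atomic_moments S \<rho> \<omega>"
  unfolding full_sequence_def
proof (rule the_equality)
  have "flat_extension l (atomic_moments S \<rho> \<omega>) (atomic_moments S \<rho> \<omega>)" if "l \<ge> n + 1" for l
    using that by (intro flat_extension_atomic_moments[OF dual_atoms_mono[OF dual] pos]) auto
  then show "(\<forall>a\<in>monomials (2 * (n + 1)). atomic_moments S \<rho> \<omega> a = \<tau> a) \<and>
      (\<forall>l\<ge>n + 1. flat_extension l (atomic_moments S \<rho> \<omega>) (atomic_moments S \<rho> \<omega>))"
    using \<tau> by simp
next
  fix \<sigma> assume \<sigma>: "(\<forall>a\<in>monomials (2 * (n + 1)). \<sigma> a = \<tau> a) \<and> (\<forall>l\<ge>n + 1. flat_extension l \<sigma> \<sigma>)"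
  show "\<sigma> = atomic_moments S \<rho> \<omega>"
  proof
    fix a :: "'d mono"
    \<comment> \<open>An order that covers the degree of \<open>a\<close> and is at least
      \<open>n + 1\<close>, so that the assumed flatness of \<open>\<sigma>\<close> is
      available.\<close>
    define l where "l = n + 1 + mdeg a"
    have "flat_form l \<sigma>" using \<sigma> by (intro flat_extension_imp_flat_form[of l \<sigma>]) (simp add: l_def)
    then interpret flat_form l \<sigma> .
    obtain N :: nat and \<rho>' \<omega>' e' where *: "dual_atoms l {1..N} \<omega>' e'" "\<And>s. s \<in> {1..N} \<Longrightarrow> \<rho>' s > 0"
      "\<And>a. a \<in> monomials (2 * (l + 1)) \<Longrightarrow> \<sigma> a = atomic_moments {1..N} \<rho>' \<omega>' a"
      by (rule atomic_representation) (assumption | rule that)+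
    have "\<tau> b = atomic_moments {1..N} \<rho>' \<omega>' b" if "b \<in> monomials (2 * (n + 1))" for b
    proof -
      have "b \<in> monomials (2 * (l + 1))" using that by (auto simp: monomials_def l_def)
      then show ?thesis using *(3)[of b] \<sigma> that by simp
    qed
    then have rep: "representing_measure (n + 1) \<tau> (atomic_measure {1..N} \<rho>' \<omega>')"
      using *(2) by (subst representing_atomic_measure_iff) (auto simp: less_imp_le)
    have "atomic_measure {1..N} \<rho>' \<omega>' = atomic_measure S \<rho> \<omega>"
      by (rule representing_measure_unique[OF dual pos \<tau> rep])
    then have "atomic_moments {1..N} \<rho>' \<omega>' = atomic_moments S \<rho> \<omega>"
      by (rule atomic_measure_moments_eq) (use *(2) pos dual in \<open>auto simp: dual_atoms_def\<close>)
    moreover have "a \<in> monomials (2 * (l + 1))" by (simp add: monomials_def l_def)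
    ultimately show "\<sigma> a = atomic_moments S \<rho> \<omega> a" using *(3) by simp
  qed
qed

text \<open>The moment matrix is a sum of \<open>card S\<close> rank-one terms. In the case of
  equality the dual vectors of this decomposition are the coefficients of interpolation polynomials;
  this is their source when only a measure is given.\<close>

lemma moment_rank_le_atoms:
  fixes \<gamma> :: "'d::finite mono \<Rightarrow> complex"
  assumes rep: "representing_measure n \<gamma> (atomic_measure S \<rho> \<omega>)"
    and fin: "finite S" and pos: "\<And>s. s \<in> S \<Longrightarrow> \<rho> s > 0"
  shows "moment_rank n \<gamma> \<le> card S"
    and "moment_rank n \<gamma> = card S \<Longrightarrow> \<exists>e. dual_atoms n S \<omega> e"
proof -
  have "\<forall>a\<in>monomials (2 * n). \<gamma> a = atomic_moments S \<rho> \<omega> a"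
    using rep representing_atomic_measure_iff[OF fin] pos by (metis less_imp_le)
  then have rank: "moment_rank n \<gamma> = moment_rank n (atomic_moments S \<rho> \<omega>)"
    by (intro moment_rank_cong) auto
  have entry: "loc_entry (atomic_moments S \<rho> \<omega>) 1 a b =
      (\<Sum>s\<in>S. (of_real (\<rho> s) * cnj (mono_eval a (\<omega> s))) * mono_eval b (\<omega> s))" for a b
    by (simp add: loc_entry_atomic_moments)
  note fins = finite_monomials[of n] fin
  show "moment_rank n \<gamma> \<le> card S"
    unfolding rank unfolding moment_rank_def by (rule rank_on_sum_le[OF fins entry])
  assume "moment_rank n \<gamma> = card S"
  then have "rank_on (monomials n) (loc_entry (atomic_moments S \<rho> \<omega>) 1) = card S"
    using rank unfolding moment_rank_def by simp
  then obtain L where L: "\<And>s t. s \<in> S \<Longrightarrow> t \<in> S \<Longrightarrow>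
      (\<Sum>b\<in>monomials n. mono_eval b (\<omega> s) * L t b) = (if s = t then 1 else 0)"
    by (rule rank_on_sum_eq_dual[OF fins entry]) (assumption | rule that)+
  have "dual_atoms n S \<omega> (\<lambda>t. zpoly_of (monomials n) (L t))"
    unfolding dual_atoms_def
  proof (intro conjI ballI)
    fix s t assume "s \<in> S" "t \<in> S"
    then show "zpoly_eval (zpoly_of (monomials n) (L s)) (\<omega> t) = (if s = t then 1 else 0)"
      using L[of t s] by (auto simp: zpoly_eval_polys[OF zpoly_of_polys] lookup_zpoly_of[OF finite_monomials])
  qed (use fin zpoly_of_polys in auto)
  then show "\<exists>e. dual_atoms n S \<omega> e" by blast
qed

text \<open>For either parity the localizing matrix has the index set of order \<open>n\<close>, the
  degree in which the interpolation polynomials are available as test vectors.\<close>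

lemma loc_index_eq:
  assumes "tdeg q = 2 * j \<or> tdeg q + 1 = 2 * j"
  shows "loc_index (n + j) q = monomials n"
proof -
  have "(tdeg q + 1) div 2 = j" using assms by auto
  then show ?thesis by (simp add: loc_index_def)
qed

text \<open>The number of atoms found is forced to be \<open>r\<close>, since interpolation makes
  the moment rank count them. Minimality holds because a measure with \<open>s\<close> atoms gives
  rank at most \<open>s\<close>.\<close>

lemma flat_extension_atomic_measure:
  fixes \<gamma> \<tau> :: "'d::finite mono \<Rightarrow> complex"
  assumes ext: "flat_extension n \<gamma> \<tau>" and r: "r = moment_rank n \<gamma>"
  obtains \<rho> \<omega> e where "dual_atoms n {1..r} \<omega> e" "\<And>s. s \<in> {1..r} \<Longrightarrow> \<rho> s > 0"
    "\<And>a. a \<in> monomials (2 * (n + 1)) \<Longrightarrow> \<tau> a = atomic_moments {1..r} \<rho> \<omega> a"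
    "minimal_atomic_measure n \<gamma> r (atomic_measure {1..r} \<rho> \<omega>)"
proof -
  interpret flat_form n \<tau> using ext by (rule flat_extension_imp_flat_form)
  obtain N :: nat and \<rho> \<omega> e where *: "dual_atoms n {1..N} \<omega> e" "\<And>s. s \<in> {1..N} \<Longrightarrow> \<rho> s > 0"
    "\<And>a. a \<in> monomials (2 * (n + 1)) \<Longrightarrow> \<tau> a = atomic_moments {1..N} \<rho> \<omega> a"
    by (rule atomic_representation) (assumption | rule that)+
  have \<gamma>: "\<gamma> a = atomic_moments {1..N} \<rho> \<omega> a" if "a \<in> monomials (2 * n)" for a
  proof -
    have "a \<in> monomials (2 * (n + 1))" using that by (simp add: monomials_def)
    then show ?thesis using *(3)[of a] ext that by (simp add: flat_extension_def)
  qed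
  have N: "N = r"
    using moment_rank_cong[of n \<gamma> "atomic_moments {1..N} \<rho> \<omega>"] \<gamma>
      moment_rank_atomic_moments[OF *(1,2)] r by simp
  have "representing_measure n \<gamma> (atomic_measure {1..r} \<rho> \<omega>)"
    using *(2) \<gamma> N by (subst representing_atomic_measure_iff) (auto simp: less_imp_le)
  moreover have "r_atomic r (atomic_measure {1..r} \<rho> \<omega>)"
    unfolding r_atomic_iff using *(2) dual_atoms_inj[OF *(1)] N by blast
  moreover have "r \<le> s" if \<mu>: "representing_measure n \<gamma> \<mu>" "r_atomic s \<mu>" for \<mu> s
  proof -
    obtain \<rho>' and \<omega>' :: "nat \<Rightarrow> complex ^ 'd" where "\<forall>s\<in>{1..s}. \<rho>' s > 0" "\<mu> = atomic_measure {1..s} \<rho>' \<omega>'"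
      using \<mu>(2) unfolding r_atomic_iff by blast
    then show ?thesis using moment_rank_le_atoms(1)[of n \<gamma> "{1..s}" \<rho>' \<omega>'] \<mu>(1) r by simp
  qed
  ultimately have "minimal_atomic_measure n \<gamma> r (atomic_measure {1..r} \<rho> \<omega>)"
    unfolding minimal_atomic_measure_def by blast
  then show thesis using that[of \<omega> e \<rho>] * unfolding N by blast
qed

theorem theorem5p1:
  fixes n m r :: nat
    and \<gamma> :: "'d::finite mono \<Rightarrow> complex"
    and p :: "nat \<Rightarrow> 'd zpoly"
    and k :: "nat \<Rightarrow> nat"
  assumes deg: "\<forall>i\<in>{1..m}. tdeg (p i) = 2 * k i \<or> tdeg (p i) + 1 = 2 * k i"
    and r: "r = moment_rank n \<gamma>"
  shows
    "((\<exists>\<nu>. minimal_atomic_measure n \<gamma> r \<nu> \<and> msupport \<nu> \<subseteq> semialg_set p m) \<longleftrightarrow>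
        moment_psd n \<gamma> \<and>
        (\<exists>\<tau>. flat_extension n \<gamma> \<tau> \<and>
             (\<forall>i\<in>{1..m}. loc_psd (n + k i) (p i) (full_sequence (n + 1) \<tau>))))
     \<and>
     (\<forall>\<tau>. moment_psd n \<gamma> \<and> flat_extension n \<gamma> \<tau> \<and>
           (\<forall>i\<in>{1..m}. loc_psd (n + k i) (p i) (full_sequence (n + 1) \<tau>)) \<longrightarrow>
        (\<exists>\<nu>. representing_measure (n + 1) \<tau> \<nu> \<and>
             (\<forall>\<mu>. representing_measure (n + 1) \<tau> \<mu> \<longrightarrow> \<mu> = \<nu>) \<and>
             minimal_atomic_measure n \<gamma> r \<nu> \<and>
             msupport \<nu> \<subseteq> semialg_set p m \<and>
             (\<forall>i\<in>{1..m}.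
                int (card {z \<in> atoms \<nu>. zpoly_eval (p i) z = 0}) =
                int r - int (loc_rank (n + k i) (p i) (full_sequence (n + 1) \<tau>)))))"
proof -
  have index: "loc_index (n + k i) (p i) = monomials n" if "i \<in> {1..m}" for i
    using deg that by (intro loc_index_eq) blast
  have necessary: "moment_psd n \<gamma> \<and> (\<exists>\<tau>. flat_extension n \<gamma> \<tau> \<and>
      (\<forall>i\<in>{1..m}. loc_psd (n + k i) (p i) (full_sequence (n + 1) \<tau>)))"
    if \<nu>: "minimal_atomic_measure n \<gamma> r \<nu>" "msupport \<nu> \<subseteq> semialg_set p m" for \<nu>
  proof -
    obtain \<rho> and \<omega> :: "nat \<Rightarrow> complex ^ 'd"
      where pos: "\<And>s. s \<in> {1..r} \<Longrightarrow> \<rho> s > 0" and \<nu>': "\<nu> = atomic_measure {1..r} \<rho> \<omega>"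
      using \<nu>(1) unfolding minimal_atomic_measure_def r_atomic_iff by blast
    have rep: "representing_measure n \<gamma> (atomic_measure {1..r} \<rho> \<omega>)"
      using \<nu>(1) \<nu>' by (simp add: minimal_atomic_measure_def)
    \<comment> \<open>The number of atoms equals the rank, which is the case that supplies
      interpolation polynomials.\<close>
    have "\<exists>e. dual_atoms n {1..r} \<omega> e"
      by (rule moment_rank_le_atoms(2)[OF rep finite_atLeastAtMost pos]) (simp_all add: r)
    then obtain e where dual: "dual_atoms n {1..r} \<omega> e" by blast
    \<comment> \<open>The measure has moments of every degree. They serve as the flat extension and
      are their own full sequence.\<close>
    define \<sigma> where "\<sigma> = atomic_moments {1..r} \<rho> \<omega>"
    have \<gamma>: "\<gamma> a = \<sigma> a" if "a \<in> monomials (2 * n)" for a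
      using rep that pos by (subst (asm) representing_atomic_measure_iff) (auto simp: \<sigma>_def less_imp_le)
    have "moment_psd n \<sigma>"
      unfolding moment_psd_def \<sigma>_def using pos by (intro psd_on_atomic_moments) (auto simp: less_imp_le)
    moreover have "mform \<gamma> f f = mform \<sigma> f f" if "f \<in> polys n" for f
      unfolding mform_def using polys_mult[OF that polys_conj[OF that]] \<gamma>
      by (intro riesz_cong_polys[of _ "2 * n"]) (auto simp: mult_2)
    ultimately have "moment_psd n \<gamma>" by (simp add: moment_psd_mform)
    moreover have "flat_extension n \<gamma> \<sigma>"
      unfolding \<sigma>_def by (rule flat_extension_atomic_moments[OF dual pos]) (auto simp: \<gamma> \<sigma>_def)
    moreover have "loc_psd (n + k i) (p i) (full_sequence (n + 1) \<sigma>)" if i: "i \<in> {1..m}" for i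
    proof -
      have "full_sequence (n + 1) \<sigma> = \<sigma>"
        unfolding \<sigma>_def by (rule full_sequence_atomic_moments[OF dual pos]) auto
      moreover have "zpoly_eval (p i) (\<omega> s) \<in> \<real>\<^sub>\<ge>\<^sub>0" if "s \<in> {1..r}" for s
      proof -
        have "msupport (atomic_measure {1..r} \<rho> \<omega>) = \<omega> ` {1..r}"
          using pos by (intro msupport_atomic_measure) auto
        then have "\<omega> s \<in> semialg_set p m" using \<nu>(2) that unfolding \<nu>' by blast
        then show ?thesis using i by (simp add: semialg_set_def)
      qed
      ultimately show ?thesis
        unfolding loc_psd_def index[OF i] \<sigma>_def using pos
        by (auto intro!: psd_on_atomic_moments simp: less_imp_le)
    qed
    ultimately show ?thesis by blast
  qed
  have sufficient: "\<exists>\<nu>. representing_measure (n + 1) \<tau> \<nu> \<and>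
      (\<forall>\<mu>. representing_measure (n + 1) \<tau> \<mu> \<longrightarrow> \<mu> = \<nu>) \<and>
      minimal_atomic_measure n \<gamma> r \<nu> \<and> msupport \<nu> \<subseteq> semialg_set p m \<and>
      (\<forall>i\<in>{1..m}. int (card {z \<in> atoms \<nu>. zpoly_eval (p i) z = 0}) =
        int r - int (loc_rank (n + k i) (p i) (full_sequence (n + 1) \<tau>)))"
    if flat: "flat_extension n \<gamma> \<tau>"
      and loc: "\<forall>i\<in>{1..m}. loc_psd (n + k i) (p i) (full_sequence (n + 1) \<tau>)" for \<tau>
  proof -
    obtain \<rho> \<omega> e where dual: "dual_atoms n {1..r} \<omega> e" and pos: "\<And>s. s \<in> {1..r} \<Longrightarrow> \<rho> s > 0"
      and \<tau>: "\<And>a. a \<in> monomials (2 * (n + 1)) \<Longrightarrow> \<tau> a = atomic_moments {1..r} \<rho> \<omega> a"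
      and min: "minimal_atomic_measure n \<gamma> r (atomic_measure {1..r} \<rho> \<omega>)"
      by (rule flat_extension_atomic_measure[OF flat r]) (assumption | rule that)+
    let ?\<nu> = "atomic_measure {1..r} \<rho> \<omega>"
    have full: "full_sequence (n + 1) \<tau> = atomic_moments {1..r} \<rho> \<omega>"
      by (rule full_sequence_atomic_moments[OF dual pos \<tau>])
    have "representing_measure (n + 1) \<tau> ?\<nu>"
      using pos \<tau> by (subst representing_atomic_measure_iff) (auto simp: less_imp_le)
    moreover have "\<mu> = ?\<nu>" if "representing_measure (n + 1) \<tau> \<mu>" for \<mu>
      by (rule representing_measure_unique[OF dual pos \<tau> that])
    moreover have "msupport ?\<nu> \<subseteq> semialg_set p m"
    proof -
      have "zpoly_eval (p i) (\<omega> s) \<in> \<real>\<^sub>\<ge>\<^sub>0" if i: "i \<in> {1..m}" and s: "s \<in> {1..r}" for i s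
      proof (rule psd_on_atomic_moments_imp[OF dual pos _ s])
        show "psd_on (monomials n) (loc_entry (atomic_moments {1..r} \<rho> \<omega>) (p i))"
          using loc i unfolding loc_psd_def full by (simp add: index)
      qed
      then show ?thesis using pos by (subst msupport_atomic_measure) (auto simp: semialg_set_def)
    qed
    moreover have "int (card {z \<in> atoms ?\<nu>. zpoly_eval (p i) z = 0}) =
        int r - int (loc_rank (n + k i) (p i) (full_sequence (n + 1) \<tau>))" if i: "i \<in> {1..m}" for i
    proof -
      \<comment> \<open>The rank of the localizing matrix is the size of \<open>?N\<close>; the
        atoms in the zero set correspond to the remaining indices.\<close>
      let ?Z = "{s\<in>{1..r}. zpoly_eval (p i) (\<omega> s) = 0}"
      let ?N = "{s\<in>{1..r}. zpoly_eval (p i) (\<omega> s) \<noteq> 0}"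
      have "atoms ?\<nu> = \<omega> ` {1..r}" using pos by (intro atoms_atomic_measure) auto
      then have "{z \<in> atoms ?\<nu>. zpoly_eval (p i) z = 0} = \<omega> ` ?Z" by auto
      moreover have "inj_on \<omega> ?Z"
        by (rule inj_on_subset[OF dual_atoms_inj[OF dual]]) auto
      ultimately have "card {z \<in> atoms ?\<nu>. zpoly_eval (p i) z = 0} = card ?Z"
        by (simp only: card_image)
      moreover have "loc_rank (n + k i) (p i) (full_sequence (n + 1) \<tau>) = card ?N"
        unfolding loc_rank_def full index[OF i]
        using pos by (intro rank_on_atomic_moments[OF dual]) fastforce
      moreover have "card (?Z \<union> ?N) = card ?Z + card ?N" by (rule card_Un_disjoint) auto
      moreover have "?Z \<union> ?N = {1..r}" by auto
      ultimately show ?thesis by simp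
    qed
    ultimately show ?thesis using min by blast
  qed
  show ?thesis
    using necessary sufficient by blast
qed

end
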